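(* Assume that a Banach space $X$ satisfies the UMD property. Then $p(X)>1$ and $q(X)<\infty$.
   Context: A Banach space $X$ has the UMD property if the Hilbert transform $H$, defined initially on $L^2(\mathbb R)\otimes X$ by $H(\sum_i\varphi_i x_i)=\sum_i (H\varphi_i)x_i$, has a bounded extension to the Lebesgue-Bochner space $L^2_X(\mathbb R)$. Let $(r_i)$ be the Rademacher functions on $[0,1]$. $X$ is of Rademacher type $p$ ($1\le p\le2$) if there is a constant $K$ such that $\int_0^1\|\sum_{i=1}^n r_i(t)x_i\|^p\,dt\le K\sum_{i=1}^n\|x_i\|^p$ for every finite family $x_1,\dots,x_n\in X$; it is of Rademacher cotype $q$ ($2\le q\le\infty$) if there is a constant $K$ such that $\sum_{i=1}^n\|x_i\|^q\le K\int_0^1\|\sum_{i=1}^n r_i(t)x_i\|^q\,dt$ for every finite family $x_1,\dots,x_n\in X$ (with the usual modification, sums and integrals replaced by suprema, when $q=\infty$). Define $p(X)=\sup\{p: X\text{ has Rademacher type }p\}$ and $q(X)=\inf\{q: X\text{ has Rademacher cotype }q\}$. *)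

theory Defs
  imports "HOL-Analysis.Analysis"
begin

text \<open>
  Strong (Bochner) measurability: almost everywhere a limit of simple functions. This is not
  Borel measurability, since \<open>X\<close> need not be separable. Functions in \<open>L\<^sup>2\<close> are represented by actual
  functions, and identities between them are asserted almost everywhere.
\<close>

definition strongly_measurable :: "(real \<Rightarrow> 'a::real_normed_vector) \<Rightarrow> bool" where
  "strongly_measurable f \<longleftrightarrow>
     (\<exists>s :: nat \<Rightarrow> real \<Rightarrow> 'a. (\<forall>n. simple_function lebesgue (s n)) \<and>
        (AE t in lebesgue. (\<lambda>n. s n t) \<longlonglongrightarrow> f t))"

definition bochner_L2 :: "(real \<Rightarrow> 'a::real_normed_vector) set" where
  "bochner_L2 = {f. strongly_measurable f \<and> integrable lebesgue (\<lambda>t. (norm (f t))\<^sup>2)}"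

definition bochner_L2_norm :: "(real \<Rightarrow> 'a::real_normed_vector) \<Rightarrow> real" where
  "bochner_L2_norm f = sqrt (LINT t|lebesgue. (norm (f t))\<^sup>2)"

text \<open>
  The Hilbert transform as a principal value. For \<open>\<phi> \<in> L\<^sup>2(\<real>)\<close> the truncated integrals converge
  absolutely, and their limit exists for almost every \<open>x\<close>; on the exceptional null set the value
  is irrelevant.
\<close>

definition hilbert_transform :: "(real \<Rightarrow> real) \<Rightarrow> real \<Rightarrow> real" where
  "hilbert_transform \<phi> x =
     Lim (at_right 0) (\<lambda>\<epsilon>. (1 / pi) * (LINT t:{t. \<epsilon> < \<bar>t\<bar>}|lebesgue. \<phi> (x - t) / t))"

text \<open>
  A bounded linear operator on \<open>L\<^sup>2\<^sub>X(\<real>)\<close>, acting on representatives. Linearity and boundedness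
  force it to respect equality almost everywhere, so it descends to classes.
\<close>

definition bounded_operator_L2 ::
    "((real \<Rightarrow> 'a::real_normed_vector) \<Rightarrow> (real \<Rightarrow> 'a)) \<Rightarrow> bool" where
  "bounded_operator_L2 T \<longleftrightarrow>
     (\<forall>f\<in>bochner_L2. T f \<in> bochner_L2) \<and>
     (\<forall>f\<in>bochner_L2. \<forall>g\<in>bochner_L2.
        AE t in lebesgue. T (\<lambda>s. f s + g s) t = T f t + T g t) \<and>
     (\<forall>c. \<forall>f\<in>bochner_L2. AE t in lebesgue. T (\<lambda>s. c *\<^sub>R f s) t = c *\<^sub>R T f t) \<and>
     (\<exists>C. \<forall>f\<in>bochner_L2. bochner_L2_norm (T f) \<le> C * bochner_L2_norm f)"

text \<open>
  Elements of \<open>L\<^sup>2(\<real>) \<otimes> X\<close> are the functions \<open>\<Sum>i<n. \<phi>\<^sub>i x\<^sub>i\<close>. Scalars are real; a complex Banach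
  space is covered through its underlying real space, since \<open>H\<close> maps real functions to real
  functions and so both tensor products give the same functions and the same operator.
\<close>

definition UMD :: "'a::banach itself \<Rightarrow> bool" where
  "UMD _ \<longleftrightarrow>
     (\<exists>T :: (real \<Rightarrow> 'a) \<Rightarrow> (real \<Rightarrow> 'a). bounded_operator_L2 T \<and>
        (\<forall>n (\<phi> :: nat \<Rightarrow> real \<Rightarrow> real) (x :: nat \<Rightarrow> 'a). (\<forall>i<n. \<phi> i \<in> bochner_L2) \<longrightarrow>
           (AE t in lebesgue. T (\<lambda>s. \<Sum>i<n. \<phi> i s *\<^sub>R x i) t =
              (\<Sum>i<n. hilbert_transform (\<phi> i) t *\<^sub>R x i))))"

text \<open>Equal to \<open>sgn (sin (2 ^ i * pi * t))\<close> except at the dyadic points where the latter vanishes.\<close>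

definition rademacher :: "nat \<Rightarrow> real \<Rightarrow> real" where
  "rademacher i t = (if even \<lfloor>2 ^ i * t\<rfloor> then 1 else - 1)"

definition rademacher_type :: "'a::banach itself \<Rightarrow> real \<Rightarrow> bool" where
  "rademacher_type _ p \<longleftrightarrow>
     (\<exists>K. \<forall>n (x :: nat \<Rightarrow> 'a).
        (LINT t:{0..1}|lborel. norm (\<Sum>i=1..n. rademacher i t *\<^sub>R x i) powr p)
          \<le> K * (\<Sum>i=1..n. norm (x i) powr p))"

text \<open>
  For \<open>q = \<infinity>\<close> the empty family is left out, because the supremum of the empty set of reals
  is unspecified.
\<close>

definition rademacher_cotype :: "'a::banach itself \<Rightarrow> ereal \<Rightarrow> bool" where
  "rademacher_cotype _ q \<longleftrightarrow>
     (if q = \<infinity> then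
        (\<exists>K. \<forall>n\<ge>1. \<forall>x :: nat \<Rightarrow> 'a.
           (SUP i\<in>{1..n}. norm (x i))
             \<le> K * (SUP t\<in>{0..1}. norm (\<Sum>i=1..n. rademacher i t *\<^sub>R x i)))
      else
        (\<exists>K. \<forall>n (x :: nat \<Rightarrow> 'a).
           (\<Sum>i=1..n. norm (x i) powr real_of_ereal q)
             \<le> K * (LINT t:{0..1}|lborel.
                       norm (\<Sum>i=1..n. rademacher i t *\<^sub>R x i) powr real_of_ereal q)))"

text \<open>
  The real supremum is a genuine one: every Banach space has type \<open>1\<close>, and the set is bounded
  by \<open>2\<close>.
\<close>

definition type_index :: "'a::banach itself \<Rightarrow> real" where
  "type_index X = Sup {p. 1 \<le> p \<and> p \<le> 2 \<and> rademacher_type X p}"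

definition cotype_index :: "'a::banach itself \<Rightarrow> ereal" where
  "cotype_index X = Inf {q. 2 \<le> q \<and> rademacher_cotype X q}"

end

theory Submission
  imports Defs
begin

text \<open>
  Apply the Hilbert transform to the function equal to \<open>y\<^sub>i\<close> on \<open>[i, i + 1)\<close>, for \<open>i < 2 * M\<close>. If the
  \<open>y\<^sub>i\<close> behave like the unit vectors of \<open>\<ell>\<^sub>1\<close>, then the norms of the tails \<open>1 / \<bar>t - i\<bar>\<close> add up to a
  harmonic sum, so the transform has norm at least a constant times \<open>ln M\<close> on half of the
  support. Hence a UMD space does not contain the spaces \<open>\<ell>\<^sub>1\<^sup>N\<close> uniformly.

  If \<open>X\<close> had no nontrivial type, the inequality \<open>E \<parallel>\<Sum> \<epsilon>\<^sub>i x\<^sub>i\<parallel>\<^sup>2 \<le> N \<Sum> \<parallel>x\<^sub>i\<parallel>\<^sup>2\<close> could not be improved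
  by a constant factor for any \<open>N\<close>, and almost extremal vectors span \<open>\<ell>\<^sub>1\<^sup>N\<close>. If \<open>X\<close> had no finite
  cotype, the same would hold for \<open>\<Sum> \<parallel>x\<^sub>i\<parallel>\<^sup>2 \<le> M E \<parallel>\<Sum> \<epsilon>\<^sub>i x\<^sub>i\<parallel>\<^sup>2\<close>, whose almost extremal vectors span
  \<open>\<ell>\<^sub>\<infinity>\<^sup>M\<close>, and \<open>\<ell>\<^sub>\<infinity>\<^sup>M\<close> contains \<open>\<ell>\<^sub>1\<^sup>N\<close> for \<open>M = 2\<^sup>N\<close>. Conversely, an improvement for a single \<open>N\<close>
  tensorises to all powers of \<open>N\<close>; splitting a family of vectors into geometric level sets of
  the norm then gives type \<open>p > 1\<close>, respectively cotype \<open>q < \<infinity>\<close>.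
\<close>

section \<open>Averages over signs\<close>

text \<open>A choice of signs is encoded as the set of indices that carry \<open>-1\<close>.
  Multiplying two choices becomes symmetric difference, and restricting a choice to \<open>J\<close>
  becomes intersection with \<open>J\<close>.\<close>

definition sign_of :: "'i set \<Rightarrow> 'i \<Rightarrow> real" where
  "sign_of A i = (if i \<in> A then -1 else 1)"

definition sign_mean :: "'i set \<Rightarrow> ('i set \<Rightarrow> real) \<Rightarrow> real" where
  "sign_mean I g = (\<Sum>A\<in>Pow I. g A) / 2 ^ card I"

definition signed_sum :: "'i set \<Rightarrow> ('i \<Rightarrow> 'a::real_normed_vector) \<Rightarrow> 'i set \<Rightarrow> 'a" where
  "signed_sum I x A = (\<Sum>i\<in>I. sign_of A i *\<^sub>R x i)"

text \<open>The second moment of the Rademacher sum, compared with the sum of squared norms from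
  above for type and from below for cotype.\<close>

definition rad2 :: "'i set \<Rightarrow> ('i \<Rightarrow> 'a::real_normed_vector) \<Rightarrow> real" where
  "rad2 I x = sign_mean I (\<lambda>A. (norm (signed_sum I x A))\<^sup>2)"

lemma abs_sign_of [simp]: "\<bar>sign_of A i\<bar> = 1"
  by (simp add: sign_of_def)

lemma sign_of_sym_diff: "sign_of (sym_diff A B) i = sign_of A i * sign_of B i"
  by (auto simp: sign_of_def)

lemma sign_mean_mono:
  assumes "\<And>A. A \<subseteq> I \<Longrightarrow> g A \<le> h A"
  shows "sign_mean I g \<le> sign_mean I h"
  unfolding sign_mean_def by (intro divide_right_mono sum_mono) (use assms in auto)

lemma sign_mean_cong:
  assumes "\<And>A. A \<subseteq> I \<Longrightarrow> g A = h A"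
  shows "sign_mean I g = sign_mean I h"
  unfolding sign_mean_def using assms by (intro arg_cong2[where f = "(/)"] sum.cong) auto

lemma sign_mean_nonneg:
  assumes "\<And>A. A \<subseteq> I \<Longrightarrow> 0 \<le> g A"
  shows "0 \<le> sign_mean I g"
  unfolding sign_mean_def by (intro divide_nonneg_pos sum_nonneg) (use assms in auto)

lemma sign_mean_const [simp]: "finite I \<Longrightarrow> sign_mean I (\<lambda>_. c) = c"
  by (simp add: sign_mean_def card_Pow)

lemma sign_mean_cmult: "sign_mean I (\<lambda>A. c * g A) = c * sign_mean I g"
  by (simp add: sign_mean_def sum_distrib_left)

lemma sign_mean_add: "sign_mean I (\<lambda>A. g A + h A) = sign_mean I g + sign_mean I h"
  by (simp add: sign_mean_def sum.distrib add_divide_distrib)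

lemma sign_mean_sum: "sign_mean I (\<lambda>A. \<Sum>j\<in>J. g j A) = (\<Sum>j\<in>J. sign_mean I (g j))"
  unfolding sign_mean_def by (subst sum.swap) (simp add: sum_divide_distrib)

lemma sign_mean_swap:
  "sign_mean I (\<lambda>A. sign_mean J (\<lambda>B. g A B)) = sign_mean J (\<lambda>B. sign_mean I (\<lambda>A. g A B))"
  unfolding sign_mean_def
  by (simp add: sum_divide_distrib[symmetric]) (subst sum.swap, simp add: mult.commute)

lemma member_le_sign_mean:
  assumes "finite I" "A \<subseteq> I" "\<And>A. A \<subseteq> I \<Longrightarrow> 0 \<le> g A"
  shows "g A \<le> 2 ^ card I * sign_mean I g"
  using member_le_sum[of A "Pow I" g] assms by (simp add: sign_mean_def)

text \<open>Fixed sign changes preserve the uniform distribution, since symmetric difference with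
  \<open>B\<close> is an involution of \<open>Pow I\<close>.\<close>

lemma sign_mean_sym_diff:
  assumes "B \<subseteq> I"
  shows "sign_mean I (\<lambda>A. g (sym_diff A B)) = sign_mean I g"
proof -
  have "(\<Sum>A\<in>Pow I. g (sym_diff A B)) = (\<Sum>A\<in>Pow I. g A)"
    by (rule sum.reindex_bij_witness[of _ "\<lambda>A. sym_diff A B" "\<lambda>A. sym_diff A B"])
      (use assms in auto)
  then show ?thesis by (simp add: sign_mean_def)
qed

text \<open>The signs on \<open>J\<close> are again uniform: each pattern on \<open>J\<close> has
  equally many extensions to \<open>I\<close>.\<close>

lemma sign_mean_Int:
  assumes "finite I" "J \<subseteq> I"
  shows "sign_mean I (\<lambda>A. g (A \<inter> J)) = sign_mean J g"
proof -
  have "(\<Sum>A\<in>Pow I. g (A \<inter> J)) = (\<Sum>(A,B)\<in>Pow J \<times> Pow (I - J). g A)"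
    by (rule sum.reindex_bij_witness[of _ "\<lambda>(A,B). A \<union> B" "\<lambda>A. (A \<inter> J, A - J)"])
      (use assms(2) in \<open>auto simp: Un_Int_distrib2 Un_Diff\<close>)
  also have "\<dots> = 2 ^ card (I - J) * (\<Sum>A\<in>Pow J. g A)"
    using assms(1) by (simp add: sum.cartesian_product[symmetric] card_Pow sum_distrib_left)
  finally have eq: "(\<Sum>A\<in>Pow I. g (A \<inter> J)) = 2 ^ card (I - J) * (\<Sum>A\<in>Pow J. g A)" .
  have "card I = card (I - J) + card J"
    using assms by (metis card_Diff_subset card_mono finite_subset le_add_diff_inverse2)
  then show ?thesis by (simp add: sign_mean_def eq power_add)
qed

lemma sign_mean_image:
  assumes "inj_on f I"
  shows "sign_mean (f ` I) g = sign_mean I (\<lambda>A. g (f ` A))"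
proof -
  have "inj_on (image f) (Pow I)"
    using assms by (auto intro!: inj_onI simp: inj_on_image_eq_iff)
  then have "(\<Sum>A\<in>Pow (f ` I). g A) = (\<Sum>A\<in>Pow I. g (f ` A))"
    by (simp add: image_Pow_surj[OF refl, symmetric] sum.reindex)
  then show ?thesis by (simp add: sign_mean_def card_image[OF assms])
qed

lemma signed_sum_sym_diff:
  "signed_sum I x (sym_diff A B) = signed_sum I (\<lambda>i. sign_of B i *\<^sub>R x i) A"
  by (simp add: signed_sum_def sign_of_sym_diff)

lemma signed_sum_cong:
  assumes "\<And>i. i \<in> I \<Longrightarrow> x i = y i"
  shows "signed_sum I x A = signed_sum I y A"
  using assms by (simp add: signed_sum_def)

lemma signed_sum_Int: "I \<subseteq> J \<Longrightarrow> signed_sum I x (A \<inter> J) = signed_sum I x A"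
  unfolding signed_sum_def sign_of_def by (intro sum.cong) auto

lemma norm_signed_sum_le: "norm (signed_sum I x A) \<le> (\<Sum>i\<in>I. norm (x i))"
  unfolding signed_sum_def by (rule order_trans[OF norm_sum]) simp

section \<open>Second moments of signed sums\<close>

lemma rad2_nonneg: "0 \<le> rad2 I x"
  unfolding rad2_def by (rule sign_mean_nonneg) simp

lemma rad2_cong: "(\<And>i. i \<in> I \<Longrightarrow> x i = y i) \<Longrightarrow> rad2 I x = rad2 I y"
  unfolding rad2_def by (simp cong: signed_sum_cong)

lemma rad2_eq_0: "(\<And>i. i \<in> I \<Longrightarrow> x i = 0) \<Longrightarrow> rad2 I x = 0"
  by (simp add: rad2_def sign_mean_def signed_sum_def)

lemma rad2_scaleR: "rad2 I (\<lambda>i. c *\<^sub>R x i) = c\<^sup>2 * rad2 I x"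
proof -
  have "signed_sum I (\<lambda>i. c *\<^sub>R x i) A = c *\<^sub>R signed_sum I x A" for A
    by (simp add: signed_sum_def scaleR_right.sum mult.commute)
  then show ?thesis by (simp add: rad2_def sign_mean_cmult power_mult_distrib)
qed

lemma rad2_sign_of:
  assumes "B \<subseteq> I"
  shows "rad2 I (\<lambda>i. sign_of B i *\<^sub>R x i) = rad2 I x"
  using sign_mean_sym_diff[OF assms, of "\<lambda>A. (norm (signed_sum I x A))\<^sup>2"]
  by (simp add: rad2_def signed_sum_sym_diff)

lemma rad2_image:
  assumes "inj_on f I"
  shows "rad2 (f ` I) x = rad2 I (x \<circ> f)"
proof -
  have "signed_sum (f ` I) x (f ` A) = signed_sum I (x \<circ> f) A" if "A \<subseteq> I" for A
    unfolding signed_sum_def sum.reindex[OF assms] o_def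
    by (intro sum.cong) (use assms that in \<open>auto simp: sign_of_def inj_on_def\<close>)
  then show ?thesis
    unfolding rad2_def sign_mean_image[OF assms] by (intro sign_mean_cong) simp
qed

text \<open>Flipping the signs outside \<open>J\<close> and adding cancels all terms outside
  \<open>J\<close>. This plays the role of conditional expectation given the signs on
  \<open>J\<close>.\<close>

lemma signed_sum_subset:
  assumes "finite I" "J \<subseteq> I"
  shows "2 *\<^sub>R signed_sum J x A = signed_sum I x A + signed_sum I x (sym_diff A (I - J))"
proof -
  have sp: "signed_sum I x B = signed_sum J x B + signed_sum (I - J) x B" for B
    unfolding signed_sum_def using sum.subset_diff[OF assms(2,1)] by (metis add.commute)
  have "signed_sum J x (sym_diff A (I - J)) = signed_sum J x A"
    "signed_sum (I - J) x (sym_diff A (I - J)) = - signed_sum (I - J) x A"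
    unfolding signed_sum_def sum_negf[symmetric] by (auto intro!: sum.cong simp: sign_of_def)
  then show ?thesis by (simp add: sp scaleR_2)
qed

text \<open>A subsum is the midpoint of two full sums with the same distribution, so by convexity
  dropping vectors cannot increase the second moment.\<close>

lemma rad2_mono:
  assumes "finite I" "J \<subseteq> I"
  shows "rad2 J x \<le> rad2 I x"
proof -
  let ?S = "signed_sum I x"
  have flip: "sign_mean I (\<lambda>A. (norm (?S (sym_diff A (I - J))))\<^sup>2) = rad2 I x"
    unfolding rad2_def by (rule sign_mean_sym_diff) auto
  have "rad2 J x = sign_mean I (\<lambda>A. (norm (signed_sum J x A))\<^sup>2)"
    unfolding rad2_def by (simp add: sign_mean_Int[OF assms, symmetric] signed_sum_Int)
  also have "\<dots> \<le> sign_mean I (\<lambda>A. 1/2 * ((norm (?S A))\<^sup>2 + (norm (?S (sym_diff A (I - J))))\<^sup>2))"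
  proof (rule sign_mean_mono)
    fix A
    have "2 *\<^sub>R signed_sum J x A = ?S A + ?S (sym_diff A (I - J))"
      by (rule signed_sum_subset[OF assms])
    then have "2 * norm (signed_sum J x A) \<le> norm (?S A) + norm (?S (sym_diff A (I - J)))"
      by (metis norm_triangle_ineq norm_scaleR abs_numeral)
    then have "(2 * norm (signed_sum J x A))\<^sup>2 \<le> (norm (?S A) + norm (?S (sym_diff A (I - J))))\<^sup>2"
      by (intro power_mono) auto
    also have "\<dots> \<le> 2 * ((norm (?S A))\<^sup>2 + (norm (?S (sym_diff A (I - J))))\<^sup>2)"
      using sum_squares_bound[of "norm (?S A)" "norm (?S (sym_diff A (I - J)))"]
      by (simp add: power2_sum)
    finally show "(norm (signed_sum J x A))\<^sup>2 \<le>
        1/2 * ((norm (?S A))\<^sup>2 + (norm (?S (sym_diff A (I - J))))\<^sup>2)"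
      by (simp add: power_mult_distrib)
  qed
  also have "\<dots> = rad2 I x"
    unfolding sign_mean_cmult sign_mean_add flip by (simp add: rad2_def)
  finally show ?thesis .
qed

lemma norm_le_rad2:
  assumes "finite I" "i \<in> I"
  shows "(norm (x i))\<^sup>2 \<le> rad2 I x"
proof -
  have "rad2 {i} x = (norm (x i))\<^sup>2"
    by (simp add: rad2_def sign_mean_def signed_sum_def Pow_insert)
  then show ?thesis using rad2_mono[of I "{i}" x] assms by simp
qed

text \<open>Multiplying each block of an independent family of signs by one more independent sign
  does not change the joint distribution.\<close>

lemma rad2_Times:
  assumes "finite U" "finite V"
  shows "rad2 (U \<times> V) x =
    sign_mean (U \<times> V) (\<lambda>B. rad2 U (\<lambda>u. signed_sum V (\<lambda>v. x (u, v)) (Pair u -` B)))"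
proof -
  have "rad2 (U \<times> V) x = sign_mean U (\<lambda>A. rad2 (U \<times> V) (\<lambda>i. sign_of (A \<times> V) i *\<^sub>R x i))"
  proof -
    have "sign_mean U (\<lambda>A. rad2 (U \<times> V) (\<lambda>i. sign_of (A \<times> V) i *\<^sub>R x i)) =
        sign_mean U (\<lambda>A. rad2 (U \<times> V) x)"
      by (intro sign_mean_cong rad2_sign_of) auto
    then show ?thesis using assms(1) by simp
  qed
  also have "\<dots> = sign_mean U (\<lambda>A. sign_mean (U \<times> V) (\<lambda>B. (norm (signed_sum U
      (\<lambda>u. signed_sum V (\<lambda>v. x (u, v)) (Pair u -` B)) A))\<^sup>2))"
    unfolding rad2_def
  proof (intro sign_mean_cong arg_cong[where f = "\<lambda>z. (norm z)\<^sup>2"])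
    fix A B
    show "signed_sum (U \<times> V) (\<lambda>i. sign_of (A \<times> V) i *\<^sub>R x i) B =
        signed_sum U (\<lambda>u. signed_sum V (\<lambda>v. x (u, v)) (Pair u -` B)) A"
      unfolding signed_sum_def scaleR_right.sum sum.cartesian_product
      by (intro sum.cong) (auto simp: sign_of_def split: if_splits)
  qed
  finally show ?thesis unfolding rad2_def by (subst (asm) sign_mean_swap)
qed

text \<open>Only the signs in row \<open>u\<close> enter, and their marginal distribution is
  uniform. This evaluates the row sums produced by \<open>rad2_Times\<close>.\<close>

lemma sign_mean_row:
  assumes "finite U" "finite V" "u \<in> U"
  shows "sign_mean (U \<times> V) (\<lambda>B. (norm (signed_sum V y (Pair u -` B)))\<^sup>2) = rad2 V y"
proof -
  have "sign_mean (U \<times> V) (\<lambda>B. (norm (signed_sum V y (Pair u -` B)))\<^sup>2) =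
      sign_mean (U \<times> V) (\<lambda>B. (norm (signed_sum V y (Pair u -` (B \<inter> Pair u ` V))))\<^sup>2)"
    unfolding signed_sum_def sign_of_def
    by (intro sign_mean_cong arg_cong[where f = "\<lambda>z. (norm z)\<^sup>2"] sum.cong) auto
  also have "\<dots> = sign_mean (Pair u ` V) (\<lambda>B. (norm (signed_sum V y (Pair u -` B)))\<^sup>2)"
    by (rule sign_mean_Int) (use assms in auto)
  also have "\<dots> = rad2 V y"
    by (simp add: sign_mean_image rad2_def inj_vimage_image_eq inj_on_def)
  finally show ?thesis .
qed

lemma rad2_Diff_zero:
  assumes "finite I" "J \<subseteq> I" "\<And>i. i \<in> I - J \<Longrightarrow> x i = 0"
  shows "rad2 I x = rad2 J x"
proof -
  have "signed_sum I x A = signed_sum J x A" for A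
    unfolding signed_sum_def by (rule sum.mono_neutral_right) (use assms in auto)
  then show ?thesis
    unfolding rad2_def by (simp add: sign_mean_Int[OF assms(1,2), symmetric] signed_sum_Int)
qed

text \<open>In this form the triangle inequality for \<open>L2_set\<close> applies.\<close>

lemma sqrt_rad2:
  "sqrt (rad2 I x) = L2_set (\<lambda>A. norm (signed_sum I x A)) (Pow I) / sqrt (2 ^ card I)"
  by (simp add: rad2_def sign_mean_def L2_set_def real_sqrt_divide)

lemma sqrt_rad2_sum_le:
  assumes "finite K"
  shows "sqrt (rad2 I (\<lambda>i. \<Sum>k\<in>K. x k i)) \<le> (\<Sum>k\<in>K. sqrt (rad2 I (x k)))"
  using assms
proof (induction K rule: finite_induct)
  case empty
  show ?case by (simp add: rad2_def sign_mean_def signed_sum_def)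
next
  case (insert k K)
  have "signed_sum I (\<lambda>i. x k i + y i) A = signed_sum I (x k) A + signed_sum I y A" for y A
    by (simp add: signed_sum_def scaleR_add_right sum.distrib)
  then have "L2_set (\<lambda>A. norm (signed_sum I (\<lambda>i. x k i + y i) A)) (Pow I) \<le>
      L2_set (\<lambda>A. norm (signed_sum I (x k) A)) (Pow I) + L2_set (\<lambda>A. norm (signed_sum I y A)) (Pow I)" for y
    by (intro order_trans[OF L2_set_mono L2_set_triangle_ineq]) (auto intro: norm_triangle_ineq)
  then have "sqrt (rad2 I (\<lambda>i. x k i + y i)) \<le> sqrt (rad2 I (x k)) + sqrt (rad2 I y)" for y
    unfolding sqrt_rad2 add_divide_distrib[symmetric] by (rule divide_right_mono) simp
  from this[of "\<lambda>i. \<Sum>k\<in>K. x k i"] insert show ?case by simp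
qed

section \<open>Transfer between index sets and tensorisation\<close>

lemma rad2_le_card:
  fixes x :: "'i \<Rightarrow> 'a::real_normed_vector"
  assumes N: "\<And>y :: nat \<Rightarrow> 'a. rad2 {..<N} y \<le> c * (\<Sum>i<N. (norm (y i))\<^sup>2)"
    and I: "finite I" "card I \<le> N"
  shows "rad2 I x \<le> c * (\<Sum>i\<in>I. (norm (x i))\<^sup>2)"
proof -
  obtain f where f: "inj_on f I" "f ` I \<subseteq> {..<N}"
    using card_le_inj[of I "{..<N}"] I by auto
  define y where "y j = (if j \<in> f ` I then x (the_inv_into I f j) else 0)" for j
  have y: "y (f i) = x i" if "i \<in> I" for i
    using that f(1) by (simp add: y_def the_inv_into_f_f)
  have "rad2 I x = rad2 I (y \<circ> f)"
    by (rule rad2_cong) (simp add: y)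
  also have "\<dots> = rad2 (f ` I) y"
    by (rule rad2_image[OF f(1), symmetric])
  also have "\<dots> = rad2 {..<N} y"
    by (rule rad2_Diff_zero[symmetric]) (use f(2) in \<open>auto simp: y_def\<close>)
  also have "\<dots> \<le> c * (\<Sum>i<N. (norm (y i))\<^sup>2)"
    by (rule N)
  also have "(\<Sum>i<N. (norm (y i))\<^sup>2) = (\<Sum>i\<in>f ` I. (norm (y i))\<^sup>2)"
    by (rule sum.mono_neutral_right) (use f(2) in \<open>auto simp: y_def\<close>)
  also have "\<dots> = (\<Sum>i\<in>I. (norm (x i))\<^sup>2)"
    by (simp add: sum.reindex[OF f(1)] y)
  finally show ?thesis .
qed

lemma le_rad2_card:
  fixes x :: "'i \<Rightarrow> 'a::real_normed_vector"
  assumes N: "\<And>y :: nat \<Rightarrow> 'a. (\<Sum>i<N. (norm (y i))\<^sup>2) \<le> d * rad2 {..<N} y"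
    and I: "finite I" "card I = N"
  shows "(\<Sum>i\<in>I. (norm (x i))\<^sup>2) \<le> d * rad2 I x"
proof -
  obtain f where f: "bij_betw f {..<N} I"
    using ex_bij_betw_nat_finite[OF I(1)] I(2) by (auto simp: atLeast0LessThan)
  then have inj: "inj_on f {..<N}" and img: "f ` {..<N} = I" by (auto simp: bij_betw_def)
  show ?thesis
    using N[of "x \<circ> f"] sum.reindex[OF inj, of "\<lambda>i. (norm (x i))\<^sup>2"]
    by (simp add: img rad2_image[OF inj, symmetric])
qed

text \<open>View the indices as an \<open>m\<close> by \<open>n\<close> grid. For fixed signs inside
  the rows, the first inequality applies to the \<open>m\<close> row sums; averaging over those
  signs leaves one second moment per row, to which the second inequality applies.\<close>

lemma rad2_le_mult:
  fixes c d :: real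
  assumes m: "\<And>y :: nat \<Rightarrow> 'a::real_normed_vector. rad2 {..<m} y \<le> c * (\<Sum>i<m. (norm (y i))\<^sup>2)"
    and n: "\<And>y :: nat \<Rightarrow> 'a. rad2 {..<n} y \<le> d * (\<Sum>i<n. (norm (y i))\<^sup>2)"
    and c: "0 \<le> c"
  shows "rad2 {..<m * n} (x :: nat \<Rightarrow> 'a) \<le> c * d * (\<Sum>i<m * n. (norm (x i))\<^sup>2)"
proof -
  let ?U = "{..<m}" and ?V = "{..<n}"
  obtain g where "bij_betw g {..<m * n} (?U \<times> ?V)"
    using ex_bij_betw_nat_finite[of "?U \<times> ?V"] by (auto simp: atLeast0LessThan)
  then have "bij_betw (the_inv_into {..<m * n} g) (?U \<times> ?V) {..<m * n}"
    by (rule bij_betw_the_inv_into)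
  then obtain f where inj: "inj_on f (?U \<times> ?V)" and img: "f ` (?U \<times> ?V) = {..<m * n}"
    by (auto simp: bij_betw_def)
  have "rad2 {..<m * n} x = rad2 (?U \<times> ?V) (x \<circ> f)"
    by (simp add: img[symmetric] rad2_image[OF inj])
  also have "\<dots> \<le> sign_mean (?U \<times> ?V)
      (\<lambda>B. c * (\<Sum>u<m. (norm (signed_sum ?V (\<lambda>v. (x \<circ> f) (u, v)) (Pair u -` B)))\<^sup>2))"
    by (subst rad2_Times) (auto intro!: sign_mean_mono m)
  also have "\<dots> = c * (\<Sum>u<m. rad2 ?V (\<lambda>v. (x \<circ> f) (u, v)))"
    unfolding sign_mean_cmult sign_mean_sum
    by (intro arg_cong2[where f = "(*)"] sum.cong refl sign_mean_row) auto
  also have "\<dots> \<le> c * (\<Sum>u<m. d * (\<Sum>v<n. (norm ((x \<circ> f) (u, v)))\<^sup>2))"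
    by (intro mult_left_mono sum_mono n c)
  also have "\<dots> = c * d * (\<Sum>i\<in>?U \<times> ?V. (norm ((x \<circ> f) i))\<^sup>2)"
    by (simp add: sum_distrib_left[symmetric] sum.cartesian_product)
  also have "(\<Sum>i\<in>?U \<times> ?V. (norm ((x \<circ> f) i))\<^sup>2) = (\<Sum>i<m * n. (norm (x i))\<^sup>2)"
    by (simp add: img[symmetric] sum.reindex[OF inj])
  finally show ?thesis .
qed

text \<open>The same grid, used in the opposite order: the inequality for \<open>n\<close> bounds
  each row, then the inequality for \<open>m\<close> bounds the row sums for fixed inner
  signs.\<close>

lemma le_rad2_mult:
  fixes c d :: real
  assumes m: "\<And>y :: nat \<Rightarrow> 'a::real_normed_vector. (\<Sum>i<m. (norm (y i))\<^sup>2) \<le> c * rad2 {..<m} y"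
    and n: "\<And>y :: nat \<Rightarrow> 'a. (\<Sum>i<n. (norm (y i))\<^sup>2) \<le> d * rad2 {..<n} y"
    and d: "0 \<le> d"
  shows "(\<Sum>i<m * n. (norm (x i))\<^sup>2) \<le> c * d * rad2 {..<m * n} (x :: nat \<Rightarrow> 'a)"
proof -
  let ?U = "{..<m}" and ?V = "{..<n}"
  obtain g where "bij_betw g {..<m * n} (?U \<times> ?V)"
    using ex_bij_betw_nat_finite[of "?U \<times> ?V"] by (auto simp: atLeast0LessThan)
  then have "bij_betw (the_inv_into {..<m * n} g) (?U \<times> ?V) {..<m * n}"
    by (rule bij_betw_the_inv_into)
  then obtain f where inj: "inj_on f (?U \<times> ?V)" and img: "f ` (?U \<times> ?V) = {..<m * n}"
    by (auto simp: bij_betw_def)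
  have "(\<Sum>i<m * n. (norm (x i))\<^sup>2) = (\<Sum>u<m. \<Sum>v<n. (norm ((x \<circ> f) (u, v)))\<^sup>2)"
    by (simp add: img[symmetric] sum.reindex[OF inj] sum.cartesian_product)
  also have "\<dots> \<le> (\<Sum>u<m. d * rad2 ?V (\<lambda>v. (x \<circ> f) (u, v)))"
    by (intro sum_mono n)
  also have "\<dots> = d * sign_mean (?U \<times> ?V)
      (\<lambda>B. \<Sum>u<m. (norm (signed_sum ?V (\<lambda>v. (x \<circ> f) (u, v)) (Pair u -` B)))\<^sup>2)"
    unfolding sign_mean_sum sum_distrib_left[symmetric]
    by (intro arg_cong2[where f = "(*)"] sum.cong refl sign_mean_row[symmetric]) auto
  also have "\<dots> \<le> d * (c * rad2 (?U \<times> ?V) (x \<circ> f))"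
    unfolding sign_mean_cmult[symmetric]
    by (subst rad2_Times) (auto intro!: sign_mean_mono mult_left_mono d m simp: sign_mean_cmult[symmetric])
  also have "rad2 (?U \<times> ?V) (x \<circ> f) = rad2 {..<m * n} x"
    by (simp add: img[symmetric] rad2_image[OF inj])
  finally show ?thesis by (simp add: ac_simps)
qed

text \<open>When \<open>c < N\<close>, this beats the constant \<open>N ^ k\<close> given by
  Cauchy-Schwarz by the factor \<open>(c / N) ^ k\<close>.\<close>

lemma rad2_le_power:
  assumes "\<And>y :: nat \<Rightarrow> 'a::real_normed_vector. rad2 {..<N} y \<le> c * (\<Sum>i<N. (norm (y i))\<^sup>2)" "0 \<le> c"
  shows "rad2 {..<N ^ k} (x :: nat \<Rightarrow> 'a) \<le> c ^ k * (\<Sum>i<N ^ k. (norm (x i))\<^sup>2)"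
proof (induction k arbitrary: x)
  case 0
  show ?case by (simp add: rad2_def sign_mean_def signed_sum_def lessThan_Suc Pow_insert)
next
  case (Suc k)
  show ?case using rad2_le_mult[OF assms(1) Suc assms(2)] by simp
qed

lemma le_rad2_power:
  assumes "\<And>y :: nat \<Rightarrow> 'a::real_normed_vector. (\<Sum>i<N. (norm (y i))\<^sup>2) \<le> d * rad2 {..<N} y" "0 \<le> d"
  shows "(\<Sum>i<N ^ k. (norm (x i))\<^sup>2) \<le> d ^ k * rad2 {..<N ^ k} (x :: nat \<Rightarrow> 'a)"
proof (induction k arbitrary: x)
  case 0
  show ?case by (simp add: rad2_def sign_mean_def signed_sum_def lessThan_Suc Pow_insert)
next
  case (Suc k)
  show ?case using le_rad2_mult[OF assms(1) Suc] assms(2) by simp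
qed

section \<open>From one improved constant to type and cotype\<close>

lemma geometric_level:
  fixes r t :: real
  assumes "0 < r" "r < 1" "0 < t" "t \<le> 1"
  shows "\<exists>k. r ^ Suc k < t \<and> t \<le> r ^ k"
proof -
  define n where "n = (LEAST n. r ^ n < t)"
  have n: "r ^ n < t"
    unfolding n_def by (rule LeastI_ex) (use real_arch_pow_inv[OF assms(3,2)] in blast)
  then have "n \<noteq> 0" using assms(4) by (intro notI) simp
  then obtain k where k: "n = Suc k" using not0_implies_Suc by blast
  have "\<not> r ^ k < t"
    using not_less_Least[of k "\<lambda>n. r ^ n < t"] unfolding n_def[symmetric] k by simp
  then show ?thesis using n k by auto
qed

text \<open>Finiteness of the family gives the common bound \<open>L\<close>; the estimates built on
  it are uniform in \<open>L\<close>. The level of a zero vector carries no information, and such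
  vectors are discarded.\<close>

lemma geometric_levels:
  fixes x :: "'i \<Rightarrow> 'a::real_normed_vector" and r s :: real
  assumes I: "finite I" and r: "0 < r" "r < 1" and s: "0 < s" "\<And>i. i \<in> I \<Longrightarrow> norm (x i) \<le> s"
  shows "\<exists>(l :: 'i \<Rightarrow> nat) (L :: nat). \<forall>i\<in>I. l i < L \<and>
    (x i \<noteq> 0 \<longrightarrow> r ^ Suc (l i) * s < norm (x i) \<and> norm (x i) \<le> r ^ l i * s)"
proof -
  have "\<exists>k. r ^ Suc k < norm (x i) / s \<and> norm (x i) / s \<le> r ^ k" if "i \<in> I" "x i \<noteq> 0" for i
    by (rule geometric_level) (use that r s in \<open>auto simp: field_simps\<close>)
  then obtain l where l: "\<And>i. i \<in> I \<Longrightarrow> x i \<noteq> 0 \<Longrightarrow>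
      r ^ Suc (l i) < norm (x i) / s \<and> norm (x i) / s \<le> r ^ l i"
    by metis
  obtain L where "l ` I \<subseteq> {..<L}"
    using finite_nat_iff_bounded[of "l ` I"] I by auto
  then show ?thesis
    using l s(1) by (intro exI[of _ l] exI[of _ L]) (auto simp: field_simps)
qed

lemma sum_power_le:
  fixes u :: real
  assumes "0 \<le> u" "u < 1"
  shows "(\<Sum>k<L. u ^ k) \<le> 1 / (1 - u)"
  using sum_le_suminf[of "\<lambda>k. u ^ k" "{..<L}"] assms suminf_geometric[of u] summable_geometric[of u]
  by auto

text \<open>With \<open>s\<close> the p-norm of the family, level \<open>k\<close> has at most
  \<open>N ^ Suc k\<close> vectors, each of norm at most \<open>r ^ k * s\<close>. The tensorised
  inequality for that many vectors costs \<open>sqrt (c * N) ^ Suc k\<close>, so the levels are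
  summable when \<open>sqrt (c * N) * r < 1\<close>.\<close>

lemma sqrt_rad2_le_powr:
  fixes x :: "'i \<Rightarrow> 'a::real_normed_vector"
  assumes N: "\<And>y :: nat \<Rightarrow> 'a. rad2 {..<N} y \<le> c * (\<Sum>i<N. (norm (y i))\<^sup>2)" "0 \<le> c"
    and r: "0 < r" "r < 1" "real N * r powr p = 1" "sqrt (c * N) * r < 1" and p: "0 < p"
    and I: "finite I"
  shows "sqrt (rad2 I x) \<le>
    sqrt (c * N) / (1 - sqrt (c * N) * r) * (\<Sum>i\<in>I. norm (x i) powr p) powr (1 / p)"
proof -
  define s where "s = (\<Sum>i\<in>I. norm (x i) powr p) powr (1 / p)"
  let ?q = "sqrt (c * N)"
  have s0: "0 \<le> s" by (simp add: s_def)
  have sp: "s powr p = (\<Sum>i\<in>I. norm (x i) powr p)"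
    using p by (simp add: s_def powr_powr sum_nonneg)
  have le_s: "norm (x i) \<le> s" if "i \<in> I" for i
  proof -
    have "norm (x i) powr p \<le> s powr p"
      unfolding sp by (rule member_le_sum) (use that I in auto)
    then have "(norm (x i) powr p) powr (1 / p) \<le> (s powr p) powr (1 / p)"
      by (rule powr_mono2[rotated 2]) (use p in auto)
    then show ?thesis using p s0 by (simp add: powr_powr)
  qed
  show ?thesis
  proof (cases "s = 0")
    case True
    then have "\<And>i. i \<in> I \<Longrightarrow> x i = 0" using le_s by force
    then have "rad2 I x = 0" by (rule rad2_eq_0)
    then show ?thesis using True by (simp add: s_def)
  next
    case False
    then have s: "0 < s" using s0 by simp
    obtain l L where l: "\<forall>i\<in>I. l i < L \<and>
        (x i \<noteq> 0 \<longrightarrow> r ^ Suc (l i) * s < norm (x i) \<and> norm (x i) \<le> r ^ l i * s)"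
      using geometric_levels[where x = x, OF I r(1,2) s le_s] by blast
    define J where "J k = {i \<in> I. x i \<noteq> 0 \<and> l i = k}" for k
    have J: "\<And>k. J k \<subseteq> I" "\<And>k i. i \<in> J k \<Longrightarrow> r ^ Suc k * s < norm (x i)"
      "\<And>k i. i \<in> J k \<Longrightarrow> norm (x i) \<le> r ^ k * s" "\<And>k k'. k \<noteq> k' \<Longrightarrow> J k \<inter> J k' = {}"
      "{i \<in> I. x i \<noteq> 0} = (\<Union>k<L. J k)"
      using l by (auto simp: J_def)
    have fin: "finite (J k)" for k using J(1) I finite_subset by blast
    \<comment> \<open>Each vector of the level contributes at least
      \<open>(r ^ Suc k * s) powr p\<close> to \<open>s powr p\<close>, and
      \<open>N * r powr p = 1\<close> turns the resulting bound into a power of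
      \<open>N\<close>.\<close>
    have card: "card (J k) \<le> N ^ Suc k" for k
    proof -
      have "real (card (J k)) * (r ^ Suc k * s) powr p = (\<Sum>i\<in>J k. (r ^ Suc k * s) powr p)"
        by simp
      also have "\<dots> \<le> (\<Sum>i\<in>J k. norm (x i) powr p)"
        by (intro sum_mono powr_mono2) (use J(2) r(1) s p in \<open>auto intro: less_imp_le\<close>)
      also have "\<dots> \<le> s powr p"
        unfolding sp by (rule sum_mono2) (use I J(1) in auto)
      finally have "real (card (J k)) * (r ^ Suc k) powr p \<le> 1"
        using s r(1) by (simp add: powr_mult mult.assoc[symmetric] del: power_Suc)
      moreover have "(r ^ Suc k) powr p = (r powr p) ^ Suc k"
        using r(1) by (simp add: powr_power powr_realpow[symmetric] powr_powr mult.commute del: power_Suc)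
      moreover have "r powr p = 1 / N" using r(3) by (cases "N = 0") (auto simp: field_simps)
      moreover have "0 < N" using r(3) by (cases N) auto
      ultimately have "real (card (J k)) * (1 / N ^ Suc k) \<le> 1" "0 < real (N ^ Suc k)"
        by (auto simp: power_one_over simp del: power_Suc)
      then have "real (card (J k)) \<le> real (N ^ Suc k)"
        by (simp add: divide_le_eq del: power_Suc)
      then show ?thesis by linarith
    qed
    have level: "sqrt (rad2 (J k) x) \<le> ?q ^ Suc k * (r ^ k * s)" for k
    proof -
      have "rad2 (J k) x \<le> c ^ Suc k * (\<Sum>i\<in>J k. (norm (x i))\<^sup>2)"
        by (rule rad2_le_card[OF rad2_le_power[OF N] fin card])
      also have "\<dots> \<le> c ^ Suc k * (\<Sum>i\<in>J k. (r ^ k * s)\<^sup>2)"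
        using J(3) N(2) by (intro mult_left_mono sum_mono power_mono) auto
      also have "\<dots> = c ^ Suc k * (card (J k) * (r ^ k * s)\<^sup>2)" by simp
      also have "\<dots> \<le> c ^ Suc k * (N ^ Suc k * (r ^ k * s)\<^sup>2)"
        using card[of k] N(2) by (intro mult_left_mono mult_right_mono) (auto simp del: power_Suc)
      finally have "sqrt (rad2 (J k) x) \<le> sqrt ((c * N) ^ Suc k * (r ^ k * s)\<^sup>2)"
        by (simp add: power_mult_distrib ac_simps)
      also have "\<dots> = ?q ^ Suc k * (r ^ k * s)"
        using s r(1) by (simp add: real_sqrt_mult[of "(c * N) ^ Suc k"] real_sqrt_power[of "c * N"] del: power_Suc)
      finally show ?thesis .
    qed
    \<comment> \<open>Each level is extended by zero to \<open>I\<close>, so that the triangle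
      inequality in L^2 can separate the levels.\<close>
    have "rad2 I x = rad2 I (\<lambda>i. \<Sum>k<L. if i \<in> J k then x i else 0)"
    proof (rule rad2_cong)
      fix i assume "i \<in> I"
      show "x i = (\<Sum>k<L. if i \<in> J k then x i else 0)"
      proof (cases "x i = 0")
        case False
        then obtain k where k: "k < L" "i \<in> J k" using J(5) \<open>i \<in> I\<close> by auto
        then have "(if i \<in> J l then x i else 0) = (if l = k then x i else 0)" for l
          using J(4)[of k l] by auto
        then show ?thesis using k by simp
      qed (simp cong: if_cong)
    qed
    then have "sqrt (rad2 I x) \<le> (\<Sum>k<L. sqrt (rad2 I (\<lambda>i. if i \<in> J k then x i else 0)))"
      using sqrt_rad2_sum_le[of "{..<L}" I] by simp
    also have "\<dots> = (\<Sum>k<L. sqrt (rad2 (J k) x))"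
      by (intro sum.cong arg_cong[where f = sqrt] refl trans[OF rad2_Diff_zero[OF I J(1)] rad2_cong]) auto
    also have "\<dots> \<le> (\<Sum>k<L. ?q * s * (?q * r) ^ k)"
      using level by (intro sum_mono) (simp add: power_mult_distrib ac_simps)
    also have "\<dots> \<le> ?q * s * (1 / (1 - ?q * r))"
      unfolding sum_distrib_left[symmetric]
      by (intro mult_left_mono sum_power_le) (use N(2) r s in auto)
    finally show ?thesis by (simp add: s_def)
  qed
qed

text \<open>A substitute for Hoelder's inequality: splitting at \<open>t \<le> w\<close> bounds
  \<open>t powr p\<close> by \<open>w powr p + w powr (p - 2) * t\<^sup>2\<close>, and both terms
  have mean at most \<open>w powr p\<close>.\<close>

lemma sign_mean_powr_le:
  assumes "finite I" "0 < w" "rad2 I x \<le> w\<^sup>2" "0 \<le> p" "p \<le> 2"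
  shows "sign_mean I (\<lambda>A. norm (signed_sum I x A) powr p) \<le> 2 * w powr p"
proof -
  have *: "t powr p \<le> w powr p + w powr (p - 2) * t\<^sup>2" if "0 \<le> t" for t :: real
  proof (cases "t \<le> w")
    case True
    then have "t powr p \<le> w powr p" using that assms(4) by (intro powr_mono2) auto
    then show ?thesis by (simp add: add_increasing2)
  next
    case False
    then have "t powr p = t powr (p - 2) * t powr 2" by (simp add: powr_add[symmetric])
    also have "\<dots> = t powr (p - 2) * t\<^sup>2" using False assms(2) by (simp add: powr_numeral)
    also have "\<dots> \<le> w powr (p - 2) * t\<^sup>2"
      using False assms by (intro mult_right_mono powr_mono2') auto
    finally show ?thesis by (simp add: add_increasing)
  qed
  have "sign_mean I (\<lambda>A. norm (signed_sum I x A) powr p) \<le>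
      sign_mean I (\<lambda>A. w powr p + w powr (p - 2) * (norm (signed_sum I x A))\<^sup>2)"
    by (intro sign_mean_mono *) simp
  also have "\<dots> = w powr p + w powr (p - 2) * rad2 I x"
    using assms(1) by (simp add: sign_mean_add sign_mean_cmult rad2_def)
  also have "\<dots> \<le> w powr p + w powr (p - 2) * w\<^sup>2"
    using assms by (intro add_left_mono mult_left_mono) auto
  also have "w\<^sup>2 = w powr 2" using assms(2) by (simp add: powr_numeral)
  also have "w powr (p - 2) * w powr 2 = w powr p" by (simp add: powr_add[symmetric])
  finally show ?thesis by simp
qed

lemma type_of_rad2_le:
  assumes N: "\<And>y :: nat \<Rightarrow> 'a::real_normed_vector. rad2 {..<N} y \<le> c * (\<Sum>i<N. (norm (y i))\<^sup>2)"
    and c: "0 < c" "c < N" and N2: "2 \<le> N"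
  obtains p K :: real where "1 < p" "p \<le> 2"
    "\<forall>(I :: nat set) (x :: nat \<Rightarrow> 'a). finite I \<longrightarrow>
      sign_mean I (\<lambda>A. norm (signed_sum I x A) powr p) \<le> K * (\<Sum>i\<in>I. norm (x i) powr p)"
proof -
  have N0: "0 < real N" using N2 by simp
  \<comment> \<open>The condition \<open>N * r powr p = 1\<close> forces
    \<open>r = N powr (- 1 / p)\<close>. At \<open>p = 1\<close> the ratio
    \<open>sqrt (c * N) * r\<close> is \<open>sqrt (c / N) < 1\<close>, so by continuity it stays
    below 1 for some \<open>p > 1\<close>.\<close>
  have "((\<lambda>p. sqrt (c * N) * real N powr (- 1 / p)) \<longlongrightarrow> sqrt (c * N) * real N powr (- 1 / 1)) (at_right 1)"
    using N0 by (intro tendsto_intros) auto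
  moreover have "sqrt (c * N) < sqrt (N * N)" using c N0 by (intro real_sqrt_less_mono) auto
  then have "sqrt (c * N) * real N powr (- 1 / 1) < 1"
    using N0 by (simp add: powr_minus field_simps)
  ultimately have "\<forall>\<^sub>F p in at_right 1. sqrt (c * N) * real N powr (- 1 / p) < 1"
    by (rule order_tendstoD)
  moreover have "\<forall>\<^sub>F p in at_right (1::real). p \<in> {1<..<2}"
    by (rule eventually_at_right_real) simp
  ultimately have "\<forall>\<^sub>F p in at_right (1::real). sqrt (c * N) * real N powr (- 1 / p) < 1 \<and> p \<in> {1<..<2}"
    by (rule eventually_conj)
  then obtain p where p: "sqrt (c * N) * real N powr (- 1 / p) < 1" "1 < p" "p < 2"
    using eventually_happens'[OF trivial_limit_at_right_real] by force
  define r where "r = real N powr (- 1 / p)"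
  have "r powr p = real N powr (- 1)" using p by (simp add: r_def powr_powr)
  moreover have "r < 1" unfolding r_def by (rule powr_less_one) (use p N2 in auto)
  ultimately have r: "0 < r" "r < 1" "real N * r powr p = 1" "sqrt (c * N) * r < 1"
    using p N0 by (auto simp: r_def powr_minus)
  define K where "K = sqrt (c * N) / (1 - sqrt (c * N) * r)"
  have K: "0 < K" using r c N0 by (simp add: K_def)
  show thesis
  proof (rule that[of p "2 * K powr p"]; (intro allI impI)?)
    fix I :: "nat set" and x :: "nat \<Rightarrow> 'a" assume I: "finite I"
    let ?s = "\<Sum>i\<in>I. norm (x i) powr p"
    show "sign_mean I (\<lambda>A. norm (signed_sum I x A) powr p) \<le> 2 * K powr p * ?s"
    proof (cases "?s = 0")
      case True
      then have "\<And>i. i \<in> I \<Longrightarrow> x i = 0" using I by (simp add: sum_nonneg_eq_0_iff)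
      then show ?thesis using True I by (simp add: signed_sum_def)
    next
      case False
      then have s: "0 < ?s" using sum_nonneg[of I "\<lambda>i. norm (x i) powr p"] by simp
      define w where "w = K * ?s powr (1 / p)"
      have w: "0 < w" using s K by (simp add: w_def)
      have "sqrt (rad2 I x) \<le> w"
        unfolding w_def K_def by (rule sqrt_rad2_le_powr[OF N]) (use c r p I in auto)
      then have "rad2 I x \<le> w\<^sup>2"
        by (rule sqrt_le_D)
      then have "sign_mean I (\<lambda>A. norm (signed_sum I x A) powr p) \<le> 2 * w powr p"
        using p w I by (intro sign_mean_powr_le) auto
      also have "w powr p = K powr p * ?s"
        using K s p by (simp add: w_def powr_mult powr_powr)
      finally show ?thesis by simp
    qed
  qed (use p in auto)
qed

section \<open>Finite cotype from an improved constant\<close>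

lemma rad2_le_sign_mean_power:
  assumes "finite I" "2 \<le> q"
  shows "sqrt (rad2 I x) ^ q \<le> 2 ^ q * sign_mean I (\<lambda>A. norm (signed_sum I x A) ^ q)"
proof (cases "rad2 I x = 0")
  case True
  then show ?thesis using assms by (simp add: power_0_left sign_mean_nonneg)
next
  case False
  let ?M = "sign_mean I (\<lambda>A. norm (signed_sum I x A) ^ q)"
  \<comment> \<open>Halving the L^2 norm makes \<open>w ^ (q - 2) * rad2 I x\<close> equal to
    \<open>4 * w ^ q\<close>, which absorbs the error \<open>w ^ q\<close> from splitting at
    \<open>t \<le> w\<close>.\<close>
  define w where "w = sqrt (rad2 I x) / 2"
  have w: "0 < w" "rad2 I x = 4 * w\<^sup>2"
    using False rad2_nonneg[of I x] by (auto simp: w_def power_divide)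
  have *: "w ^ (q - 2) * t\<^sup>2 \<le> w ^ q + t ^ q" if "0 \<le> t" for t :: real
  proof -
    have q: "z ^ q = z ^ (q - 2) * z\<^sup>2" for z :: real
      using assms(2) by (metis le_add_diff_inverse2 power_add)
    show ?thesis
    proof (cases "t \<le> w")
      case True
      then have "w ^ (q - 2) * t\<^sup>2 \<le> w ^ q"
        unfolding q[of w] using that w by (intro mult_left_mono power_mono) auto
      then show ?thesis using that by (simp add: add_increasing2)
    next
      case False
      then have "w ^ (q - 2) * t\<^sup>2 \<le> t ^ q"
        unfolding q[of t] using w by (intro mult_right_mono power_mono) auto
      then show ?thesis using w by (simp add: add_increasing)
    qed
  qed
  have "w ^ (q - 2) * rad2 I x \<le> sign_mean I (\<lambda>A. w ^ q + norm (signed_sum I x A) ^ q)"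
    unfolding rad2_def sign_mean_cmult[symmetric] by (intro sign_mean_mono *) simp
  also have "\<dots> = w ^ q + ?M" using assms by (simp add: sign_mean_add)
  also have "w ^ (q - 2) * rad2 I x = 4 * w ^ q"
    using assms(2) unfolding w(2) by (metis le_add_diff_inverse2 mult.left_commute power_add)
  finally have "w ^ q \<le> ?M" using zero_le_power[of w q] w by linarith
  then show ?thesis by (simp add: w_def power_divide field_simps)
qed

text \<open>The number \<open>s = sqrt (rad2 I x)\<close> dominates every norm. With
  \<open>r\<^sup>2 = d / N\<close>, more than \<open>N ^ Suc k\<close> vectors on level
  \<open>k\<close> would contradict the tensorised inequality. Level \<open>k\<close> thus
  contributes at most \<open>N * s ^ q * (N * r ^ q) ^ k\<close>, which is summable for large
  \<open>q\<close>.\<close>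

lemma cotype_of_le_rad2:
  assumes N: "\<And>y :: nat \<Rightarrow> 'a::real_normed_vector. (\<Sum>i<N. (norm (y i))\<^sup>2) \<le> d * rad2 {..<N} y"
    and d: "0 < d" "d < N"
  obtains q :: nat and K :: real where "2 \<le> q"
    "\<forall>(I :: nat set) (x :: nat \<Rightarrow> 'a). finite I \<longrightarrow>
      (\<Sum>i\<in>I. norm (x i) ^ q) \<le> K * sign_mean I (\<lambda>A. norm (signed_sum I x A) ^ q)"
proof -
  define r where "r = sqrt (d / N)"
  have N0: "0 < real N" using d by linarith
  have r: "0 < r" "r < 1" "r\<^sup>2 = d / N" using d N0 by (auto simp: r_def)
  obtain q0 where q0: "r ^ q0 < 1 / N" using real_arch_pow_inv[of "1 / N" r] r N0 by auto
  define q where "q = q0 + 2"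
  define u where "u = N * r ^ q"
  have "r ^ q \<le> r ^ q0" using r by (intro power_decreasing) (auto simp: q_def)
  then have "r ^ q < 1 / N" using q0 by simp
  then have u: "0 \<le> u" "u < 1" using N0 r(1) by (auto simp: u_def field_simps)
  have main: "(\<Sum>i\<in>I. norm (x i) ^ q) \<le> N / (1 - u) * sqrt (rad2 I x) ^ q"
    if I: "finite I" for I and x :: "nat \<Rightarrow> 'a"
  proof (cases "rad2 I x = 0")
    case True
    then have "\<And>i. i \<in> I \<Longrightarrow> x i = 0" using norm_le_rad2[OF I, of _ x] by force
    then show ?thesis using True by (simp add: q_def)
  next
    case False
    define s where "s = sqrt (rad2 I x)"
    have s: "0 < s" "s\<^sup>2 = rad2 I x" using False rad2_nonneg[of I x] by (auto simp: s_def)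
    have le_s: "norm (x i) \<le> s" if "i \<in> I" for i
      unfolding s_def by (rule real_le_rsqrt) (rule norm_le_rad2[OF I that])
    obtain l L where l: "\<forall>i\<in>I. l i < L \<and>
        (x i \<noteq> 0 \<longrightarrow> r ^ Suc (l i) * s < norm (x i) \<and> norm (x i) \<le> r ^ l i * s)"
      using geometric_levels[where x = x, OF I r(1,2) s(1) le_s] by blast
    define J where "J k = {i \<in> I. x i \<noteq> 0 \<and> l i = k}" for k
    have J: "\<And>k. J k \<subseteq> I" "\<And>k i. i \<in> J k \<Longrightarrow> r ^ Suc k * s < norm (x i)"
      "\<And>k i. i \<in> J k \<Longrightarrow> norm (x i) \<le> r ^ k * s" "\<And>k k'. k \<noteq> k' \<Longrightarrow> J k \<inter> J k' = {}"
      "{i \<in> I. x i \<noteq> 0} = (\<Union>k<L. J k)"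
      using l by (auto simp: J_def)
    have fin: "finite (J k)" for k using J(1) I finite_subset by blast
    have card: "card (J k) \<le> N ^ Suc k" for k
    proof (rule ccontr)
      assume "\<not> ?thesis"
      \<comment> \<open>The tensorised inequality is applied to exactly \<open>N ^ Suc k\<close>
        vectors. Their squared norms add up to more than
        \<open>N ^ Suc k * (r ^ Suc k * s)\<^sup>2\<close>, which already equals the upper bound
        \<open>d ^ Suc k * s\<^sup>2\<close>.\<close>
      then obtain J' where J': "J' \<subseteq> J k" "card J' = N ^ Suc k"
        by (meson nat_le_linear obtain_subset_with_card_n)
      have fin': "finite J'" "J' \<noteq> {}" using J' fin finite_subset N0 by auto
      have rs: "(r ^ Suc k * s)\<^sup>2 = (d / N) ^ Suc k * s\<^sup>2"
        unfolding r(3)[symmetric] by (simp add: power_mult_distrib power_mult[symmetric] mult.commute)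
      have "N ^ Suc k * (r ^ Suc k * s)\<^sup>2 = (\<Sum>i\<in>J'. (r ^ Suc k * s)\<^sup>2)" by (simp add: J'(2))
      also have "\<dots> < (\<Sum>i\<in>J'. (norm (x i))\<^sup>2)"
        by (intro sum_strict_mono power_strict_mono fin') (use J(2) J'(1) r s in auto)
      also have "\<dots> \<le> d ^ Suc k * rad2 J' x"
        by (rule le_rad2_card[OF le_rad2_power[OF N] fin'(1) J'(2)]) (use d in simp)
      also have "\<dots> \<le> d ^ Suc k * s\<^sup>2"
        unfolding s(2) using J'(1) J(1)[of k] d I by (intro mult_left_mono rad2_mono) auto
      finally show False unfolding rs using N0 by (simp add: power_divide)
    qed
    have "(\<Sum>i\<in>I. norm (x i) ^ q) = (\<Sum>i\<in>(\<Union>k<L. J k). norm (x i) ^ q)"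
      unfolding J(5)[symmetric] by (rule sum.mono_neutral_right) (use I in \<open>auto simp: q_def\<close>)
    also have "\<dots> = (\<Sum>k<L. \<Sum>i\<in>J k. norm (x i) ^ q)"
      by (rule sum.UNION_disjoint) (use fin J(4) in auto)
    also have "\<dots> \<le> (\<Sum>k<L. (N * s ^ q) * u ^ k)"
    proof (rule sum_mono)
      fix k
      have "(\<Sum>i\<in>J k. norm (x i) ^ q) \<le> (\<Sum>i\<in>J k. (r ^ k * s) ^ q)"
        using J(3) by (intro sum_mono power_mono) auto
      also have "\<dots> = card (J k) * (r ^ k * s) ^ q" by simp
      also have "\<dots> \<le> real (N ^ Suc k) * (r ^ k * s) ^ q"
        using card[of k] r s by (intro mult_right_mono) (auto simp del: power_Suc)
      also have "\<dots> = (N * s ^ q) * u ^ k"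
        by (simp add: u_def power_mult_distrib power_mult[symmetric] mult.commute[of q])
      finally show "(\<Sum>i\<in>J k. norm (x i) ^ q) \<le> (N * s ^ q) * u ^ k" .
    qed
    also have "\<dots> \<le> (N * s ^ q) * (1 / (1 - u))"
      unfolding sum_distrib_left[symmetric]
      by (intro mult_left_mono sum_power_le u) (use s in auto)
    finally show ?thesis by (simp add: s_def)
  qed
  show thesis
  proof (rule that[of q "N / (1 - u) * 2 ^ q"]; (intro allI impI)?)
    fix I :: "nat set" and x :: "nat \<Rightarrow> 'a" assume I: "finite I"
    have "(\<Sum>i\<in>I. norm (x i) ^ q) \<le> N / (1 - u) * sqrt (rad2 I x) ^ q" by (rule main[OF I])
    also have "\<dots> \<le> N / (1 - u) * (2 ^ q * sign_mean I (\<lambda>A. norm (signed_sum I x A) ^ q))"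
      using u by (intro mult_left_mono rad2_le_sign_mean_power[OF I]) (auto simp: q_def)
    finally show "(\<Sum>i\<in>I. norm (x i) ^ q) \<le>
        N / (1 - u) * 2 ^ q * sign_mean I (\<lambda>A. norm (signed_sum I x A) ^ q)"
      by (simp add: mult.assoc)
  qed (simp add: q_def)
qed

section \<open>Almost extremal families\<close>

text \<open>A coefficient in \<open>[-1, 1]\<close> is a convex combination of the two signs, so the
  vertices control the whole cube. The shift \<open>z\<close> absorbs the coordinates already split
  off in the induction.\<close>

lemma norm_add_sum_scaleR_le:
  fixes x :: "'i \<Rightarrow> 'a::real_normed_vector"
  assumes "finite I" "\<And>A. A \<subseteq> I \<Longrightarrow> norm (z + signed_sum I x A) \<le> K" "\<And>i. i \<in> I \<Longrightarrow> \<bar>b i\<bar> \<le> 1"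
  shows "norm (z + (\<Sum>i\<in>I. b i *\<^sub>R x i)) \<le> K"
  using assms
proof (induction I arbitrary: z rule: finite_induct)
  case empty
  then show ?case by (simp add: signed_sum_def)
next
  case (insert i I)
  let ?S = "\<Sum>j\<in>I. b j *\<^sub>R x j"
  have b: "-1 \<le> b i" "b i \<le> 1" using insert.prems(2)[of i] by auto
  have "signed_sum I x (insert i A) = signed_sum I x A" for A
    unfolding signed_sum_def using insert.hyps by (intro sum.cong) (auto simp: sign_of_def)
  moreover have "signed_sum (insert i I) x A = sign_of A i *\<^sub>R x i + signed_sum I x A" for A
    using insert.hyps by (simp add: signed_sum_def)
  ultimately have *: "signed_sum (insert i I) x (insert i A) = - x i + signed_sum I x A"
    "i \<notin> A \<Longrightarrow> signed_sum (insert i I) x A = x i + signed_sum I x A" for A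
    by (auto simp: sign_of_def)
  have "norm (z + x i + signed_sum I x A) \<le> K" "norm (z - x i + signed_sum I x A) \<le> K" if "A \<subseteq> I" for A
  proof -
    have "i \<notin> A" using that insert.hyps by blast
    then show "norm (z + x i + signed_sum I x A) \<le> K" "norm (z - x i + signed_sum I x A) \<le> K"
      using insert.prems(1)[of A] insert.prems(1)[of "insert i A"] that * by (auto simp: algebra_simps)
  qed
  then have "norm (z + x i + ?S) \<le> K" "norm (z - x i + ?S) \<le> K"
    using insert.prems(2) by (auto intro!: insert.IH)
  then have "norm (((1 + b i) / 2) *\<^sub>R (z + x i + ?S)) + norm (((1 - b i) / 2) *\<^sub>R (z - x i + ?S))
      \<le> (1 + b i) / 2 * K + (1 - b i) / 2 * K"
    unfolding norm_scaleR using b by (intro add_mono mult_mono) auto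
  also have "\<dots> = K" by (simp add: field_simps)
  finally have "norm (((1 + b i) / 2) *\<^sub>R (z + x i + ?S)) + norm (((1 - b i) / 2) *\<^sub>R (z - x i + ?S)) \<le> K" .
  moreover have "((1 + b i) / 2) *\<^sub>R (z + x i + ?S) + ((1 - b i) / 2) *\<^sub>R (z - x i + ?S)
      = z + (b i *\<^sub>R x i + ?S)"
  proof -
    have "((1 + b i) / 2) *\<^sub>R (z + ?S) + ((1 - b i) / 2) *\<^sub>R (z + ?S) = z + ?S"
      by (simp add: scaleR_add_left[symmetric] field_simps)
    moreover have "((1 + b i) / 2) *\<^sub>R x i - ((1 - b i) / 2) *\<^sub>R x i = b i *\<^sub>R x i"
      by (simp add: scaleR_diff_left[symmetric] field_simps)
    ultimately show ?thesis by (simp add: algebra_simps)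
  qed
  ultimately have "norm (z + (b i *\<^sub>R x i + ?S)) \<le> K"
    using norm_triangle_ineq[of "((1 + b i) / 2) *\<^sub>R (z + x i + ?S)" "((1 - b i) / 2) *\<^sub>R (z - x i + ?S)"]
    by simp
  then show ?case using insert.hyps by simp
qed

lemma norm_sum_scaleR_le_signed_sum:
  fixes x :: "'i \<Rightarrow> 'a::real_normed_vector"
  assumes "finite I" "\<And>A. A \<subseteq> I \<Longrightarrow> norm (signed_sum I x A) \<le> K" "\<And>i. i \<in> I \<Longrightarrow> \<bar>b i\<bar> \<le> s"
    and "0 \<le> s"
  shows "norm (\<Sum>i\<in>I. b i *\<^sub>R x i) \<le> s * K"
proof (cases "s = 0")
  case True
  then show ?thesis using assms(3) by simp
next
  case False
  then have s: "0 < s" using assms(4) by simp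
  have "norm (0 + (\<Sum>i\<in>I. (b i / s) *\<^sub>R x i)) \<le> K"
    by (rule norm_add_sum_scaleR_le) (use assms s in auto)
  moreover have "(\<Sum>i\<in>I. b i *\<^sub>R x i) = s *\<^sub>R (\<Sum>i\<in>I. (b i / s) *\<^sub>R x i)"
    using s by (simp add: scaleR_right.sum)
  ultimately show ?thesis using s by simp
qed

text \<open>The ratio of second moment to sum of squares is invariant under scaling, so an almost
  extremal family can be normalised.\<close>

lemma rescale_sum_norm_square:
  fixes x :: "'i \<Rightarrow> 'a::real_normed_vector"
  assumes "0 < (\<Sum>i\<in>I. (norm (x i))\<^sup>2)" "0 < t"
  obtains c where "(\<Sum>i\<in>I. (norm (c *\<^sub>R x i))\<^sup>2) = t"
    "rad2 I (\<lambda>i. c *\<^sub>R x i) = t / (\<Sum>i\<in>I. (norm (x i))\<^sup>2) * rad2 I x"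
proof
  let ?S = "\<Sum>i\<in>I. (norm (x i))\<^sup>2"
  have c: "(sqrt (t / ?S))\<^sup>2 = t / ?S" using assms by simp
  show "(\<Sum>i\<in>I. (norm (sqrt (t / ?S) *\<^sub>R x i))\<^sup>2) = t"
    using assms unfolding norm_scaleR power_mult_distrib power2_abs c sum_distrib_left[symmetric] by simp
  show "rad2 I (\<lambda>i. sqrt (t / ?S) *\<^sub>R x i) = t / ?S * rad2 I x"
    unfolding rad2_scaleR c ..
qed

text \<open>After normalisation no signed sum has norm above \<open>N\<close>. A second moment close
  to \<open>N\<^sup>2\<close> then forces all \<open>2 ^ N\<close> signed sums to have norm close to
  \<open>N\<close>, and hence each vector to have norm close to 1. So no choice of signs loses much
  in the triangle inequality.\<close>

lemma ell1_of_rad2_large: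
  fixes N :: nat
  assumes N: "0 < N"
    and large: "\<And>c::real. 0 < c \<Longrightarrow> c < N \<Longrightarrow>
      \<exists>x :: nat \<Rightarrow> 'a::real_normed_vector. c * (\<Sum>i<N. (norm (x i))\<^sup>2) < rad2 {..<N} x"
  shows "\<exists>y :: nat \<Rightarrow> 'a. (\<forall>i<N. norm (y i) \<le> 2) \<and>
    (\<forall>a. 1 / 2 * (\<Sum>i<N. \<bar>a i\<bar>) \<le> norm (\<Sum>i<N. a i *\<^sub>R y i))"
proof -
  \<comment> \<open>The factor \<open>2 ^ N\<close> pays for passing from the mean to a single sign
    pattern: \<open>2 ^ N * (\<delta> * N * N) = N / 32\<close>.\<close>
  define \<delta> where "\<delta> = 1 / (32 * real N * 2 ^ N)"
  have "32 * 1 * 1 \<le> 32 * real N * 2 ^ N"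
    using N by (intro mult_mono) auto
  then have \<delta>: "0 < \<delta>" "\<delta> < 1" using N by (auto simp: \<delta>_def field_simps)
  have "0 < (1 - \<delta>) * N" "(1 - \<delta>) * N < N" using \<delta> N by auto
  from large[OF this] obtain x0 :: "nat \<Rightarrow> 'a" where
    x0: "(1 - \<delta>) * N * (\<Sum>i<N. (norm (x0 i))\<^sup>2) < rad2 {..<N} x0" by blast
  have pos: "0 < (\<Sum>i<N. (norm (x0 i))\<^sup>2)"
  proof (rule ccontr)
    assume "\<not> ?thesis"
    then have "(\<Sum>i<N. (norm (x0 i))\<^sup>2) = 0" by (smt (verit) sum_nonneg zero_le_power2)
    moreover from this have "rad2 {..<N} x0 = 0"
      by (intro rad2_eq_0) (auto simp: sum_nonneg_eq_0_iff)
    ultimately show False using x0 by simp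
  qed
  obtain t where t: "(\<Sum>i<N. (norm (t *\<^sub>R x0 i))\<^sup>2) = real N"
    "rad2 {..<N} (\<lambda>i. t *\<^sub>R x0 i) = real N / (\<Sum>i<N. (norm (x0 i))\<^sup>2) * rad2 {..<N} x0"
    using rescale_sum_norm_square[OF pos, of "real N"] N by (metis of_nat_0_less_iff)
  define x where "x = (\<lambda>i. t *\<^sub>R x0 i)"
  let ?S = "signed_sum {..<N} x"
  have "N / (\<Sum>i<N. (norm (x0 i))\<^sup>2) * ((1 - \<delta>) * N * (\<Sum>i<N. (norm (x0 i))\<^sup>2)) < rad2 {..<N} x"
    unfolding x_def t(2) by (intro mult_strict_left_mono x0) (use pos N in auto)
  then have x: "(\<Sum>i<N. (norm (x i))\<^sup>2) = N" "(1 - \<delta>) * N * N < rad2 {..<N} x"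
    using t(1) pos by (auto simp: x_def mult.commute)
  define T where "T = (\<Sum>i<N. norm (x i))"
  \<comment> \<open>The deficit \<open>N - T\<close> measures how far the norms are from 1; that it
    is nonnegative is Cauchy-Schwarz.\<close>
  have var: "(\<Sum>i<N. (norm (x i) - 1)\<^sup>2) = 2 * (N - T)"
  proof -
    have "(\<Sum>i<N. (norm (x i) - 1)\<^sup>2) = (\<Sum>i<N. (norm (x i))\<^sup>2 + 1 - 2 * norm (x i))"
      by (simp add: power2_diff)
    also have "\<dots> = real N + real N - 2 * T"
      unfolding sum_subtractf sum.distrib x(1) T_def sum_distrib_left by simp
    finally show ?thesis by simp
  qed
  then have TN: "T \<le> N" by (smt (verit) sum_nonneg zero_le_power2)
  have S_le: "norm (?S A) \<le> N" for A
    using norm_signed_sum_le[of "{..<N}" x A] TN by (simp add: T_def)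
  have S_ge: "N - 1 / 32 \<le> norm (?S A)" if "A \<subseteq> {..<N}" for A
  proof -
    have "(real N)\<^sup>2 - (norm (?S A))\<^sup>2 \<le> 2 ^ card {..<N} * sign_mean {..<N} (\<lambda>A. (real N)\<^sup>2 - (norm (?S A))\<^sup>2)"
      by (rule member_le_sign_mean) (use that S_le in \<open>auto intro!: power_mono\<close>)
    also have "sign_mean {..<N} (\<lambda>A. (real N)\<^sup>2 - (norm (?S A))\<^sup>2) =
        (real N)\<^sup>2 + (-1) * rad2 {..<N} x"
      using sign_mean_add[of "{..<N}" "\<lambda>_. (real N)\<^sup>2" "\<lambda>A. (-1) * (norm (?S A))\<^sup>2"]
      unfolding sign_mean_cmult by (simp add: rad2_def)
    also have "\<dots> \<le> \<delta> * N * N" using x(2) by (simp add: power2_eq_square algebra_simps)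
    also have "2 ^ card {..<N} * (\<delta> * N * N) = N / 32"
      using N by (simp add: \<delta>_def)
    finally have "real N * (real N - 1 / 32) \<le> (norm (?S A))\<^sup>2"
      by (simp add: power2_eq_square algebra_simps)
    also have "\<dots> \<le> real N * norm (?S A)"
      unfolding power2_eq_square by (intro mult_right_mono S_le) simp
    finally show ?thesis using N by simp
  qed
  have "N - 1 / 32 \<le> T"
    using S_ge[of "{}"] norm_signed_sum_le[of "{..<N}" x "{}"] by (simp add: T_def)
  then have TS: "T - norm (?S A) \<le> 1 / 32" "2 * (N - T) \<le> (1 / 4)\<^sup>2" if "A \<subseteq> {..<N}" for A
    using S_ge[OF that] TN by (auto simp: power2_eq_square)
  have close: "3 / 4 \<le> norm (x i)" "norm (x i) \<le> 2" if "i < N" for i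
  proof -
    have "(norm (x i) - 1)\<^sup>2 \<le> (\<Sum>i<N. (norm (x i) - 1)\<^sup>2)"
      by (rule member_le_sum) (use that in auto)
    also have "\<dots> \<le> (1 / 4)\<^sup>2" using var TS(2)[of "{}"] by simp
    finally have "\<bar>norm (x i) - 1\<bar> \<le> \<bar>1 / 4\<bar>" unfolding abs_le_square_iff .
    then show "3 / 4 \<le> norm (x i)" "norm (x i) \<le> 2" by linarith+
  qed
  have low: "1 / 2 * (\<Sum>i<N. \<bar>a i\<bar>) \<le> norm (\<Sum>i<N. a i *\<^sub>R x i)" for a
  proof -
    define K where "K = (\<Sum>i<N. \<bar>a i\<bar>)"
    define A where "A = {i. i < N \<and> a i < 0}"
    have K: "\<bar>a i\<bar> \<le> K" if "i < N" for i
      unfolding K_def by (rule member_le_sum) (use that in auto)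
    have K0: "0 \<le> K" by (simp add: K_def sum_nonneg)
    \<comment> \<open>The pattern \<open>A\<close> matches the signs of \<open>a\<close>, so the
      remainder has the nonnegative weights \<open>K - \<bar>a i\<bar>\<close> and the triangle
      inequality suffices for it. What is left is at least
      \<open>(3 / 4 - 1 / 32) * K\<close>.\<close>
    have "K *\<^sub>R ?S A = (\<Sum>i<N. a i *\<^sub>R x i) + (\<Sum>i<N. ((K - \<bar>a i\<bar>) * sign_of A i) *\<^sub>R x i)"
      unfolding signed_sum_def scaleR_right.sum sum.distrib[symmetric]
      by (intro sum.cong) (auto simp: sign_of_def A_def algebra_simps)
    then have "norm (K *\<^sub>R ?S A) \<le> norm (\<Sum>i<N. a i *\<^sub>R x i) + norm (\<Sum>i<N. ((K - \<bar>a i\<bar>) * sign_of A i) *\<^sub>R x i)"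
      by (simp only: norm_triangle_ineq)
    also have "norm (\<Sum>i<N. ((K - \<bar>a i\<bar>) * sign_of A i) *\<^sub>R x i) \<le> (\<Sum>i<N. (K - \<bar>a i\<bar>) * norm (x i))"
      by (rule order_trans[OF norm_sum]) (use K in \<open>auto intro!: sum_mono simp: abs_mult\<close>)
    also have "\<dots> = K * T - (\<Sum>i<N. \<bar>a i\<bar> * norm (x i))"
      by (simp add: T_def left_diff_distrib sum_subtractf sum_distrib_left)
    finally have "norm (K *\<^sub>R ?S A) \<le> norm (\<Sum>i<N. a i *\<^sub>R x i) + (K * T - (\<Sum>i<N. \<bar>a i\<bar> * norm (x i)))"
      by simp
    then have "(\<Sum>i<N. \<bar>a i\<bar> * norm (x i)) - K * (T - norm (?S A)) \<le> norm (\<Sum>i<N. a i *\<^sub>R x i)"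
      using K0 by (simp add: algebra_simps)
    moreover have "K * (T - norm (?S A)) \<le> K * (1 / 32)"
      by (intro mult_left_mono TS(1) K0) (auto simp: A_def)
    moreover have "(\<Sum>i<N. \<bar>a i\<bar> * norm (x i)) \<ge> (\<Sum>i<N. \<bar>a i\<bar> * (3 / 4))"
      by (intro sum_mono mult_left_mono close) auto
    then have "(\<Sum>i<N. \<bar>a i\<bar> * norm (x i)) \<ge> K * (3 / 4)"
      by (simp add: K_def sum_divide_distrib[symmetric] sum_distrib_right[symmetric])
    ultimately show ?thesis using K0 unfolding K_def[symmetric] by linarith
  qed
  show ?thesis by (intro exI[of _ x] conjI allI impI close low)
qed

section \<open>Almost extremal families for cotype\<close>

lemma norm_le_sign_mean_norm:
  assumes "finite I" "i \<in> I"
  shows "norm (x i) \<le> sign_mean I (\<lambda>A. norm (signed_sum I x A))"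
proof -
  let ?S = "signed_sum I x"
  \<comment> \<open>Flipping every sign except that of \<open>i\<close> cancels all the other
    vectors.\<close>
  have "2 * norm (x i) \<le> norm (?S A) + norm (?S (sym_diff A (I - {i})))" for A
    using signed_sum_subset[OF assms(1), of "{i}" x A] assms(2)
      norm_triangle_ineq[of "?S A" "?S (sym_diff A (I - {i}))"]
      norm_scaleR[of 2 "signed_sum {i} x A"]
    by (simp add: signed_sum_def[of "{i}"] abs_mult)
  then have "sign_mean I (\<lambda>A. 2 * norm (x i)) \<le>
      sign_mean I (\<lambda>A. norm (?S A) + norm (?S (sym_diff A (I - {i}))))"
    by (intro sign_mean_mono)
  also have "\<dots> = 2 * sign_mean I (\<lambda>A. norm (?S A))"
    using sign_mean_sym_diff[of "I - {i}" I "\<lambda>A. norm (?S A)"] by (simp add: sign_mean_add)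
  finally show ?thesis using assms(1) by simp
qed

text \<open>Every squared norm is at most the second moment, which is below
  \<open>1 + \<delta>\<close> after normalisation; as the squares add up to \<open>M\<close>, none
  is much below 1. The norm of the signed sum then has first and second moment close to 1, so its
  mean square distance from 1 is small, and so is its distance for every sign pattern.\<close>

lemma ell_infinity_of_rad2_small:
  fixes M :: nat
  assumes M: "0 < M"
    and small: "\<And>d::real. 0 < d \<Longrightarrow> d < M \<Longrightarrow>
      \<exists>x :: nat \<Rightarrow> 'a::real_normed_vector. d * rad2 {..<M} x < (\<Sum>i<M. (norm (x i))\<^sup>2)"
  shows "\<exists>x :: nat \<Rightarrow> 'a. (\<forall>i<M. 5 / 6 \<le> norm (x i)) \<and>
    (\<forall>A\<subseteq>{..<M}. norm (signed_sum {..<M} x A) \<le> 7 / 6)"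
proof -
  \<comment> \<open>Chosen so that \<open>2 ^ M * (3 * (M * \<delta>)) = 1 / 36\<close>, the square
    of the allowed deviation \<open>1 / 6\<close>.\<close>
  define \<delta> where "\<delta> = 1 / (108 * real M * 2 ^ M)"
  have M1: "1 \<le> real M" using M by simp
  have \<delta>: "0 < \<delta>" using M by (simp add: \<delta>_def)
  have "0 < M / (1 + \<delta>)" "M / (1 + \<delta>) < M" using \<delta> M by (auto simp: field_simps)
  from small[OF this] obtain x0 :: "nat \<Rightarrow> 'a" where
    x0: "M / (1 + \<delta>) * rad2 {..<M} x0 < (\<Sum>i<M. (norm (x0 i))\<^sup>2)" by blast
  have "0 \<le> M / (1 + \<delta>) * rad2 {..<M} x0" using \<delta> by (simp add: rad2_nonneg)
  then have pos: "0 < (\<Sum>i<M. (norm (x0 i))\<^sup>2)" using x0 by linarith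
  obtain t where t: "(\<Sum>i<M. (norm (t *\<^sub>R x0 i))\<^sup>2) = real M"
    "rad2 {..<M} (\<lambda>i. t *\<^sub>R x0 i) = real M / (\<Sum>i<M. (norm (x0 i))\<^sup>2) * rad2 {..<M} x0"
    using rescale_sum_norm_square[OF pos, of "real M"] M by (metis of_nat_0_less_iff)
  define x where "x = (\<lambda>i. t *\<^sub>R x0 i)"
  let ?S = "signed_sum {..<M} x"
  have "rad2 {..<M} x = (1 + \<delta>) * (M / (1 + \<delta>) * rad2 {..<M} x0) / (\<Sum>i<M. (norm (x0 i))\<^sup>2)"
    unfolding x_def t(2) using \<delta> by simp
  also have "\<dots> < (1 + \<delta>) * (\<Sum>i<M. (norm (x0 i))\<^sup>2) / (\<Sum>i<M. (norm (x0 i))\<^sup>2)"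
    by (intro divide_strict_right_mono mult_strict_left_mono x0 pos) (use \<delta> in simp)
  finally have x: "(\<Sum>i<M. (norm (x i))\<^sup>2) = M" "rad2 {..<M} x < 1 + \<delta>"
    using t(1) pos by (auto simp: x_def)
  have "M * \<delta> = 1 / (108 * 2 ^ M)" using M by (simp add: \<delta>_def)
  also have "\<dots> \<le> 1 / 108" by (simp add: field_simps)
  finally have M\<delta>: "M * \<delta> \<le> 1 / 108" .
  have low: "1 - M * \<delta> \<le> norm (x i)" if i: "i < M" for i
  proof -
    have "real M = (norm (x i))\<^sup>2 + (\<Sum>j\<in>{..<M} - {i}. (norm (x j))\<^sup>2)"
      using x(1) i by (simp add: sum.remove[of "{..<M}" i])
    also have "(\<Sum>j\<in>{..<M} - {i}. (norm (x j))\<^sup>2) \<le> (\<Sum>j\<in>{..<M} - {i}. 1 + \<delta>)"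
      by (intro sum_mono order_trans[OF norm_le_rad2[of "{..<M}"] less_imp_le[OF x(2)]]) auto
    also have "\<dots> = (real M - 1) * (1 + \<delta>)" using i by (simp add: of_nat_diff)
    finally have sq: "1 - M * \<delta> \<le> (norm (x i))\<^sup>2" using \<delta> by (simp add: algebra_simps)
    show ?thesis
    proof (cases "norm (x i) \<le> 1")
      case True
      then have "(norm (x i))\<^sup>2 \<le> norm (x i)"
        by (simp add: power2_eq_square mult_left_le)
      then show ?thesis using sq by linarith
    qed (use \<delta> M1 in \<open>auto intro: order_trans[of _ 1]\<close>)
  qed
  have "1 - M * \<delta> \<le> sign_mean {..<M} (\<lambda>A. norm (?S A))"
    using low[OF M] norm_le_sign_mean_norm[of "{..<M}" 0 x] M by simp
  moreover have "sign_mean {..<M} (\<lambda>A. (norm (?S A) - 1)\<^sup>2) =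
      rad2 {..<M} x - 2 * sign_mean {..<M} (\<lambda>A. norm (?S A)) + 1"
  proof -
    have "(\<lambda>A. (norm (?S A) - 1)\<^sup>2) = (\<lambda>A. (norm (?S A))\<^sup>2 + ((-2) * norm (?S A) + 1))"
      by (auto simp: power2_diff)
    then show ?thesis by (simp only: sign_mean_add sign_mean_cmult) (simp add: rad2_def)
  qed
  ultimately have var: "sign_mean {..<M} (\<lambda>A. (norm (?S A) - 1)\<^sup>2) \<le> \<delta> + 2 * (M * \<delta>)"
    using x(2) by linarith
  have up: "norm (?S A) \<le> 7 / 6" if "A \<subseteq> {..<M}" for A
  proof -
    have "(norm (?S A) - 1)\<^sup>2 \<le> 2 ^ card {..<M} * sign_mean {..<M} (\<lambda>A. (norm (?S A) - 1)\<^sup>2)"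
      by (rule member_le_sign_mean) (use that in auto)
    also have "\<dots> \<le> 2 ^ card {..<M} * (3 * (M * \<delta>))"
      using var mult_right_mono[OF M1, of \<delta>] \<delta> by (intro mult_left_mono) (linarith, simp)
    also have "\<dots> = (1 / 6)\<^sup>2" using M by (simp add: \<delta>_def power2_eq_square)
    finally have "\<bar>norm (?S A) - 1\<bar> \<le> \<bar>1 / 6\<bar>" unfolding abs_le_square_iff .
    then show ?thesis by linarith
  qed
  have "5 / 6 \<le> norm (x i)" if "i < M" for i using low[OF that] M\<delta> by linarith
  then show ?thesis using up by (intro exI[of _ x]) simp
qed

text \<open>The coordinates of \<open>ell_infinity^M\<close> with \<open>M = 2 ^ N\<close> are
  labelled by the sign patterns on \<open>N\<close> indices, and \<open>y i\<close> has the sign of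
  \<open>i\<close> as its coefficients. For any \<open>a\<close>, the coordinate whose pattern
  matches the signs of \<open>a\<close> carries the full sum of absolute values.\<close>

lemma ell1_of_rad2_small:
  fixes N :: nat
  assumes small: "\<And>d::real. 0 < d \<Longrightarrow> d < 2 ^ N \<Longrightarrow>
      \<exists>x :: nat \<Rightarrow> 'a::real_normed_vector. d * rad2 {..<2 ^ N} x < (\<Sum>i<2 ^ N. (norm (x i))\<^sup>2)"
  shows "\<exists>y :: nat \<Rightarrow> 'a. (\<forall>i<N. norm (y i) \<le> 2) \<and>
    (\<forall>a. 1 / 2 * (\<Sum>i<N. \<bar>a i\<bar>) \<le> norm (\<Sum>i<N. a i *\<^sub>R y i))"
proof -
  define M :: nat where "M = 2 ^ N"
  obtain x :: "nat \<Rightarrow> 'a" where x: "\<And>i. i < M \<Longrightarrow> 5 / 6 \<le> norm (x i)"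
    "\<And>A. A \<subseteq> {..<M} \<Longrightarrow> norm (signed_sum {..<M} x A) \<le> 7 / 6"
  proof -
    have "\<exists>x :: nat \<Rightarrow> 'a. (\<forall>i<M. 5 / 6 \<le> norm (x i)) \<and>
        (\<forall>A\<subseteq>{..<M}. norm (signed_sum {..<M} x A) \<le> 7 / 6)"
      by (rule ell_infinity_of_rad2_small) (use small in \<open>auto simp: M_def\<close>)
    then show ?thesis using that by auto
  qed
  obtain e where e: "bij_betw e {..<M} (Pow {..<N})"
    using ex_bij_betw_nat_finite[of "Pow {..<N}"] by (auto simp: atLeast0LessThan card_Pow M_def)
  define y where "y i = (\<Sum>j<M. sign_of (e j) i *\<^sub>R x j)" for i
  have up: "norm (y i) \<le> 2" for i
  proof -
    have sub: "{j. j < M \<and> i \<in> e j} \<subseteq> {..<M}" by auto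
    have "y i = signed_sum {..<M} x {j. j < M \<and> i \<in> e j}"
      unfolding y_def signed_sum_def by (intro sum.cong) (auto simp: sign_of_def)
    then show ?thesis using x(2)[OF sub] by simp
  qed
  have low: "1 / 2 * (\<Sum>i<N. \<bar>a i\<bar>) \<le> norm (\<Sum>i<N. a i *\<^sub>R y i)" for a
  proof -
    define s where "s = (\<Sum>i<N. \<bar>a i\<bar>)"
    define b where "b j = (\<Sum>i<N. a i * sign_of (e j) i)" for j
    have s0: "0 \<le> s" by (simp add: s_def sum_nonneg)
    have eq: "(\<Sum>i<N. a i *\<^sub>R y i) = (\<Sum>j<M. b j *\<^sub>R x j)"
      unfolding y_def b_def scaleR_right.sum scaleR_left.sum by (subst sum.swap) simp
    have b: "\<bar>b j\<bar> \<le> s" for j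
      unfolding b_def s_def by (rule order_trans[OF sum_abs]) (simp add: abs_mult)
    obtain k where k: "k < M" "e k = {i. i < N \<and> a i < 0}"
    proof -
      have "{i. i < N \<and> a i < 0} \<in> e ` {..<M}"
        unfolding bij_betw_imp_surj_on[OF e] by auto
      then show ?thesis using that by auto
    qed
    have bk: "b k = s"
      unfolding b_def s_def by (intro sum.cong) (auto simp: k(2) sign_of_def)
    \<comment> \<open>Convexity gives only upper bounds for combinations, so the lower bound comes
      from flipping the largest coefficient: the two sums differ by \<open>2 * s\<close> times
      \<open>x k\<close>, and \<open>2 * (5 / 6) - 7 / 6 = 1 / 2\<close>.\<close>
    define b' where "b' j = (if j = k then - b k else b j)" for j
    have "norm (\<Sum>j<M. b' j *\<^sub>R x j) \<le> s * (7 / 6)"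
      by (rule norm_sum_scaleR_le_signed_sum) (use x(2) b s0 in \<open>auto simp: b'_def\<close>)
    moreover have "(\<Sum>j<M. b j *\<^sub>R x j) - (\<Sum>j<M. b' j *\<^sub>R x j) = (2 * s) *\<^sub>R x k"
    proof -
      have "(\<Sum>j<M. b j *\<^sub>R x j) - (\<Sum>j<M. b' j *\<^sub>R x j) = (\<Sum>j<M. if j = k then (2 * s) *\<^sub>R x k else 0)"
        unfolding sum_subtractf[symmetric]
        by (intro sum.cong) (auto simp: b'_def bk scaleR_add_left[symmetric])
      then show ?thesis using k(1) by simp
    qed
    then have "2 * s * norm (x k) \<le> norm (\<Sum>j<M. b j *\<^sub>R x j) + norm (\<Sum>j<M. b' j *\<^sub>R x j)"
      using norm_triangle_ineq4[of "\<Sum>j<M. b j *\<^sub>R x j" "\<Sum>j<M. b' j *\<^sub>R x j"] s0 by simp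
    moreover have "2 * s * (5 / 6) \<le> 2 * s * norm (x k)"
      using s0 by (intro mult_left_mono x(1) k(1)) auto
    ultimately show ?thesis unfolding eq s_def[symmetric] by linarith
  qed
  show ?thesis by (intro exI[of _ y] conjI allI impI up low)
qed

section \<open>Rademacher functions as signs\<close>

text \<open>On this dyadic interval the floor of \<open>2 ^ i * t\<close> is
  \<open>k div 2 ^ (n - i)\<close>, whose parity is the binary digit \<open>n - i\<close> of
  \<open>k\<close>.\<close>

lemma rademacher_dyadic:
  assumes i: "1 \<le> i" "i \<le> n" and t: "real k / 2 ^ n \<le> t" "t < real (Suc k) / 2 ^ n"
  shows "rademacher i t = (if bit k (n - i) then - 1 else 1)"
proof -
  have p: "(2::real) ^ n = 2 ^ i * 2 ^ (n - i)" using i by (simp add: power_add[symmetric])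
  have "real k \<le> 2 ^ n * t" "2 ^ n * t < real (Suc k)" using t by (auto simp: field_simps)
  then have k: "\<lfloor>2 ^ n * t\<rfloor> = int k" by linarith
  have "2 ^ i * t = 2 ^ n * t / real_of_int (2 ^ (n - i))" by (simp add: p)
  also have "\<lfloor>\<dots>\<rfloor> = \<lfloor>2 ^ n * t\<rfloor> div 2 ^ (n - i)"
    by (rule floor_divide_real_eq_div) simp
  finally have "\<lfloor>2 ^ i * t\<rfloor> = int (k div 2 ^ (n - i))" by (simp add: k zdiv_int)
  then show ?thesis by (simp add: rademacher_def bit_iff_odd)
qed

lemma bij_betw_bits:
  "bij_betw (\<lambda>k. {i \<in> {1..n}. bit k (n - i)}) {..<2 ^ n :: nat} (Pow {1..n})"
proof (rule bij_betw_imageI)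
  show inj: "inj_on (\<lambda>k. {i \<in> {1..n}. bit k (n - i)}) {..<2 ^ n :: nat}"
  proof (rule inj_onI)
    fix k l :: nat
    assume kl: "k \<in> {..<2 ^ n}" "l \<in> {..<2 ^ n}"
      and eq: "{i \<in> {1..n}. bit k (n - i)} = {i \<in> {1..n}. bit l (n - i)}"
    have "bit k j = bit l j" for j
    proof (cases "j < n")
      case True
      then have "n - j \<in> {1..n}" "n - (n - j) = j" by auto
      then show ?thesis using eq by (metis (mono_tags, lifting) mem_Collect_eq)
    next
      case False
      then show ?thesis
        using kl by (metis bit_take_bit_iff lessThan_iff take_bit_nat_eq_self_iff)
    qed
    then show "k = l" by (rule bit_eqI)
  qed
  show "(\<lambda>k. {i \<in> {1..n}. bit k (n - i)}) ` {..<2 ^ n :: nat} = Pow {1..n}"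
    by (rule card_subset_eq) (use card_image[OF inj] in \<open>auto simp: card_Pow\<close>)
qed

text \<open>Across the \<open>2 ^ n\<close> dyadic intervals the first \<open>n\<close> Rademacher
  functions take each sign pattern exactly once, so the integrand is a step function with equally
  long steps.\<close>

lemma integral_rademacher:
  fixes x :: "nat \<Rightarrow> 'a::real_normed_vector" and g :: "real \<Rightarrow> real"
  shows "(LINT t:{0..1}|lborel. g (norm (\<Sum>i=1..n. rademacher i t *\<^sub>R x i))) =
    sign_mean {1..n} (\<lambda>A. g (norm (signed_sum {1..n} x A)))"
proof -
  define h where "h t = g (norm (\<Sum>i=1..n. rademacher i t *\<^sub>R x i))" for t
  define D where "D k = {real k / 2 ^ n..<real (Suc k) / 2 ^ n}" for k
  define c where "c k = g (norm (signed_sum {1..n} x {i \<in> {1..n}. bit k (n - i)}))" for k :: nat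
  have h: "h t = c k" if "t \<in> D k" for t k
    unfolding h_def c_def signed_sum_def using that
    by (intro arg_cong[where f = "\<lambda>z. g (norm z)"] sum.cong)
      (auto simp: D_def sign_of_def rademacher_dyadic)
  have D_iff: "t \<in> D k \<longleftrightarrow> 0 \<le> t \<and> k = nat \<lfloor>2 ^ n * t\<rfloor>" for t k
  proof -
    have "t \<in> D k \<longleftrightarrow> real k \<le> 2 ^ n * t \<and> 2 ^ n * t < real k + 1"
      by (auto simp: D_def field_simps)
    also have "\<dots> \<longleftrightarrow> int k = \<lfloor>2 ^ n * t\<rfloor>" by linarith
    also have "\<dots> \<longleftrightarrow> 0 \<le> t \<and> k = nat \<lfloor>2 ^ n * t\<rfloor>"
      by (auto simp: zero_le_mult_iff)
        (metis of_nat_0_le_iff zero_le_floor zero_le_mult_iff zero_less_numeral zero_less_power not_less)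
    finally show ?thesis .
  qed
  \<comment> \<open>The half-open intervals with \<open>k < 2 ^ n\<close> leave out the endpoint 1,
    which enters as a separate null term.\<close>
  have split: "indicator {0..1} t *\<^sub>R h t = (\<Sum>k<2 ^ n. c k * indicator (D k) t) + h 1 * indicator {1} t"
    for t :: real
  proof (cases "0 \<le> t \<and> t < 1")
    case True
    define l where "l = nat \<lfloor>2 ^ n * t\<rfloor>"
    have "2 ^ n * t < 2 ^ n" using True by simp
    then have l: "l < 2 ^ n" using True by (simp add: l_def nat_less_iff floor_less_iff)
    have tl: "t \<in> D l" using True by (simp add: D_iff l_def)
    have "(\<Sum>k<2 ^ n. c k * indicator (D k) t) = (\<Sum>k<2 ^ n. if k = l then c l else 0)"
      using True by (intro sum.cong) (auto simp: D_iff l_def indicator_def)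
    also have "\<dots> = h t" using l h[OF tl] by simp
    finally show ?thesis using True by (simp add: indicator_def)
  next
    case False
    have "t \<notin> D k" if "k < 2 ^ n" for k
    proof
      assume "t \<in> D k"
      then have "0 \<le> t" "int k = \<lfloor>2 ^ n * t\<rfloor>" by (auto simp: D_iff)
      moreover from this False have "real (2 ^ n) \<le> 2 ^ n * t" by simp
      then have "int (2 ^ n) \<le> \<lfloor>2 ^ n * t\<rfloor>" by linarith
      ultimately show False using that by linarith
    qed
    then have "(\<Sum>k<2 ^ n. c k * indicator (D k) t) = 0"
      by (intro sum.neutral) (auto simp: indicator_def)
    then show ?thesis using False by (auto simp: indicator_def)
  qed
  have D: "has_bochner_integral lborel (\<lambda>t. c k * indicator (D k) t) (c k * (1 / 2 ^ n))" for k
    using has_bochner_integral_real_indicator[of "D k" lborel]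
    by (intro has_bochner_integral_mult_right) (auto simp: D_def diff_divide_distrib[symmetric] divide_right_mono)
  have "has_bochner_integral lborel (\<lambda>t. h 1 * indicator {1} t) (h 1 * 0)"
    using has_bochner_integral_real_indicator[of "{1}" lborel] by (intro has_bochner_integral_mult_right) auto
  then have "has_bochner_integral lborel (\<lambda>t. (\<Sum>k<2 ^ n. c k * indicator (D k) t) + h 1 * indicator {1} t)
      ((\<Sum>k<2 ^ n. c k * (1 / 2 ^ n)) + h 1 * 0)"
    by (intro has_bochner_integral_add has_bochner_integral_sum D)
  then have "(LINT t:{0..1}|lborel. h t) = (\<Sum>k<2 ^ n. c k / 2 ^ n)"
    unfolding set_lebesgue_integral_def split by (auto dest: has_bochner_integral_integral_eq)
  also have "\<dots> = (\<Sum>A\<in>Pow {1..n}. g (norm (signed_sum {1..n} x A))) / 2 ^ n"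
    unfolding c_def sum_divide_distrib[symmetric]
    using sum.reindex_bij_betw[OF bij_betw_bits, of "\<lambda>A. g (norm (signed_sum {1..n} x A))" n] by simp
  finally show ?thesis by (simp add: h_def sign_mean_def)
qed

section \<open>The Hilbert transform\<close>

text \<open>The interval lies at positive distance to the right of \<open>x\<close>, so small
  truncations have no effect and the principal value is an ordinary integral. On its domain
  \<open>1 / t\<close> is at most \<open>- 1 / (b - x)\<close>, so nothing cancels.\<close>

lemma abs_hilbert_transform_indicator_ge:
  assumes "x < a" "a \<le> b"
  shows "(b - a) / (pi * (b - x)) \<le> \<bar>hilbert_transform (indicator {a..<b}) x\<bar>"
proof -
  let ?Q = "{x - b<..x - a}"
  define V where "V = (LINT t|lebesgue. indicator ?Q t * (1 / t))"
  have trunc: "(LINT t:{t. \<epsilon> < \<bar>t\<bar>}|lebesgue. indicator {a..<b} (x - t) / t) = V"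
    if "\<epsilon> \<in> {0<..<a - x}" for \<epsilon>
    unfolding set_lebesgue_integral_def V_def
    by (intro arg_cong[where f = "integral\<^sup>L lebesgue"] ext) (use that assms in \<open>auto simp: indicator_def\<close>)
  have "\<forall>\<^sub>F \<epsilon> in at_right 0. 1 / pi * (LINT t:{t. \<epsilon> < \<bar>t\<bar>}|lebesgue. indicator {a..<b} (x - t) / t) = 1 / pi * V"
    using eventually_at_right_real[of 0 "a - x"] assms by (auto elim!: eventually_mono simp: trunc)
  then have H: "hilbert_transform (indicator {a..<b}) x = 1 / pi * V"
    unfolding hilbert_transform_def
    by (intro tendsto_Lim tendsto_eventually) (auto simp: trivial_limit_at_right_real)
  have "set_integrable lebesgue {x - b..x - a} (\<lambda>t. 1 / t)"
    by (intro absolutely_integrable_continuous_real continuous_intros) (use assms in auto)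
  then have "set_integrable lebesgue ?Q (\<lambda>t. 1 / t)"
    by (rule set_integrable_subset) auto
  then have int: "integrable lebesgue (\<lambda>t. - (indicator ?Q t * (1 / t)))"
    by (simp add: set_integrable_def)
  have ind: "has_bochner_integral lebesgue (\<lambda>t. indicator ?Q t * (1 / (b - x))) ((b - a) * (1 / (b - x)))"
    using has_bochner_integral_real_indicator[of ?Q lebesgue] assms
    by (intro has_bochner_integral_mult_left) (auto simp: measure_completion emeasure_completion)
  have "(b - a) * (1 / (b - x)) = (LINT t|lebesgue. indicator ?Q t * (1 / (b - x)))"
    by (rule has_bochner_integral_integral_eq[OF ind, symmetric])
  also have "\<dots> \<le> (LINT t|lebesgue. - (indicator ?Q t * (1 / t)))"
    by (rule integral_mono[OF integrable.intros[OF ind] int])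
      (use assms in \<open>auto simp: indicator_def divide_simps\<close>)
  also have "\<dots> = - V" by (simp add: V_def)
  finally have "(b - a) / (b - x) \<le> \<bar>V\<bar>" by simp
  then have "(b - a) / (b - x) / pi \<le> \<bar>V\<bar> / pi" by (rule divide_right_mono) simp
  then show ?thesis unfolding H by (simp add: abs_mult mult.commute)
qed

section \<open>Test functions constant on unit intervals\<close>

lemma simple_function_imp_strongly_measurable:
  "simple_function lebesgue f \<Longrightarrow> strongly_measurable f"
  unfolding strongly_measurable_def by (rule exI[of _ "\<lambda>_. f"]) simp

text \<open>Each point meets at most one unit interval, so sums over \<open>i\<close> collapse to a
  single term.\<close>

lemma indicator_unit_interval:
  "indicator {real i..<real i + 1} s = (if 0 \<le> s \<and> i = nat \<lfloor>s\<rfloor> then 1 else 0 :: real)"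
proof -
  have "s \<in> {real i..<real i + 1} \<longleftrightarrow> int i = \<lfloor>s\<rfloor>" by (auto; linarith)
  also have "\<dots> \<longleftrightarrow> 0 \<le> s \<and> i = nat \<lfloor>s\<rfloor>"
    by auto (metis of_nat_0_le_iff zero_le_floor)
  finally show ?thesis by (simp add: indicator_def)
qed

lemma UMD_not_ell1:
  assumes "UMD TYPE('a::banach)"
  obtains N :: nat where "2 \<le> N"
    "\<nexists>y :: nat \<Rightarrow> 'a. (\<forall>i<N. norm (y i) \<le> 2) \<and>
      (\<forall>a. 1 / 2 * (\<Sum>i<N. \<bar>a i\<bar>) \<le> norm (\<Sum>i<N. a i *\<^sub>R y i))"
proof -
  obtain T :: "(real \<Rightarrow> 'a) \<Rightarrow> (real \<Rightarrow> 'a)" where T: "bounded_operator_L2 T"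
    and TH: "\<And>n (\<phi> :: nat \<Rightarrow> real \<Rightarrow> real) (x :: nat \<Rightarrow> 'a). (\<And>i. i < n \<Longrightarrow> \<phi> i \<in> bochner_L2) \<Longrightarrow>
      (AE t in lebesgue. T (\<lambda>s. \<Sum>i<n. \<phi> i s *\<^sub>R x i) t = (\<Sum>i<n. hilbert_transform (\<phi> i) t *\<^sub>R x i))"
    using assms unfolding UMD_def by blast
  obtain C where C: "\<And>f. f \<in> bochner_L2 \<Longrightarrow> bochner_L2_norm (T f) \<le> C * bochner_L2_norm f"
    using T unfolding bounded_operator_L2_def by blast
  have TL: "T f \<in> bochner_L2" if "f \<in> bochner_L2" for f
    using T that unfolding bounded_operator_L2_def by blast
  define S where "S m = (\<Sum>k<m. 1 / (real k + 2))" for m :: nat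
  have "filterlim (harm :: nat \<Rightarrow> real) at_top sequentially"
    by (rule harm_at_top)
  \<comment> \<open>The summand 1 accounts for the first harmonic term, absent from
    \<open>S\<close>. The rest makes the later pointwise bound \<open>h\<close> exceed
    \<open>3 * \<bar>C\<bar>\<close>; the sign of \<open>C\<close> is unknown.\<close>
  then obtain M0 where M0: "\<And>m. M0 \<le> m \<Longrightarrow> 1 + 6 * pi * (\<bar>C\<bar> + 1) \<le> (harm m :: real)"
    unfolding filterlim_at_top eventually_sequentially by blast
  define M where "M = Suc M0"
  have "(harm (Suc m) :: real) = 1 + S m" for m
    by (induction m) (auto simp: S_def harm_Suc harm_def inverse_eq_divide)
  then have SM: "6 * pi * (\<bar>C\<bar> + 1) \<le> S M"
    using M0[of "Suc M"] by (simp add: M_def)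
  define h where "h = S M / (2 * pi)"
  have h: "3 * (\<bar>C\<bar> + 1) \<le> h"
    using SM by (simp add: h_def field_simps)
  have "\<nexists>y :: nat \<Rightarrow> 'a. (\<forall>i<2 * M. norm (y i) \<le> 2) \<and>
      (\<forall>a. 1 / 2 * (\<Sum>i<2 * M. \<bar>a i\<bar>) \<le> norm (\<Sum>i<2 * M. a i *\<^sub>R y i))"
  proof (rule notI, elim exE conjE)
    fix y :: "nat \<Rightarrow> 'a"
    assume y2: "\<forall>i<2 * M. norm (y i) \<le> 2"
      and y1: "\<forall>a. 1 / 2 * (\<Sum>i<2 * M. \<bar>a i\<bar>) \<le> norm (\<Sum>i<2 * M. a i *\<^sub>R y i)"
    define \<phi> :: "nat \<Rightarrow> real \<Rightarrow> real" where "\<phi> i = indicator {real i..<real i + 1}" for i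
    define f where "f s = (\<Sum>i<2 * M. \<phi> i s *\<^sub>R y i)" for s
    have \<phi>_int: "has_bochner_integral lebesgue (\<phi> i) 1" for i
      using has_bochner_integral_real_indicator[of "{real i..<real i + 1}" lebesgue]
      by (simp add: \<phi>_def measure_completion emeasure_completion)
    have \<phi>_simple: "simple_function lebesgue (\<phi> i)" for i
      by (simp add: \<phi>_def)
    have \<phi>_L2: "\<phi> i \<in> bochner_L2" for i
    proof -
      have "(\<lambda>t. (norm (\<phi> i t))\<^sup>2) = \<phi> i" by (auto simp: \<phi>_def indicator_def)
      then show ?thesis
        using \<phi>_int[of i] simple_function_imp_strongly_measurable[OF \<phi>_simple]
        by (auto simp: bochner_L2_def has_bochner_integral_iff)
    qed
    have norm_f: "(norm (f s))\<^sup>2 = (\<Sum>i<2 * M. (norm (y i))\<^sup>2 * \<phi> i s)" for s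
    proof -
      have "f s = (\<Sum>i<2 * M. if i = nat \<lfloor>s\<rfloor> then (if 0 \<le> s then y i else 0) else 0)"
        unfolding f_def \<phi>_def indicator_unit_interval by (intro sum.cong) auto
      moreover have "(\<Sum>i<2 * M. (norm (y i))\<^sup>2 * \<phi> i s) =
          (\<Sum>i<2 * M. if i = nat \<lfloor>s\<rfloor> then (if 0 \<le> s then (norm (y i))\<^sup>2 else 0) else 0)"
        unfolding \<phi>_def indicator_unit_interval by (intro sum.cong) auto
      ultimately show ?thesis by simp
    qed
    have f_int: "has_bochner_integral lebesgue (\<lambda>s. (norm (f s))\<^sup>2) (\<Sum>i<2 * M. (norm (y i))\<^sup>2 * 1)"
      unfolding norm_f by (intro has_bochner_integral_sum has_bochner_integral_mult_right \<phi>_int)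
    have "simple_function lebesgue f"
      unfolding f_def by (intro simple_function_sum simple_function_compose1[OF \<phi>_simple])
    then have f_L2: "f \<in> bochner_L2"
      using f_int by (auto simp: bochner_L2_def has_bochner_integral_iff simple_function_imp_strongly_measurable)
    have "(bochner_L2_norm f)\<^sup>2 = (\<Sum>i<2 * M. (norm (y i))\<^sup>2)"
      using f_int by (simp add: bochner_L2_norm_def has_bochner_integral_iff sum_nonneg)
    also have "\<dots> \<le> (\<Sum>i<2 * M. 2\<^sup>2)"
      using y2 by (intro sum_mono power_mono) auto
    finally have f_le: "(bochner_L2_norm f)\<^sup>2 \<le> 8 * M" by simp
    have AE: "AE t in lebesgue. T f t = (\<Sum>i<2 * M. hilbert_transform (\<phi> i) t *\<^sub>R y i)"
      using TH[of "2 * M" \<phi> y] \<phi>_L2 by (simp add: f_def[abs_def])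
    \<comment> \<open>Only intervals to the right of \<open>t\<close> are used. For \<open>t\<close>
      in \<open>[j, j + 1)\<close>, the one starting at \<open>j + 1 + k\<close> ends within
      distance \<open>k + 2\<close> of \<open>t\<close>, and \<open>2 * M\<close> intervals leave
      \<open>M\<close> of them for every \<open>t < M\<close>. The lower bound for \<open>y\<close>
      holds whatever the signs of the coefficients.\<close>
    have low: "h \<le> norm (\<Sum>i<2 * M. hilbert_transform (\<phi> i) t *\<^sub>R y i)" if t: "t \<in> {0..<real M}" for t
    proof -
      define j where "j = nat \<lfloor>t\<rfloor>"
      have j: "real j \<le> t" "t < real j + 1" "j < M" using t unfolding j_def by (auto; linarith)+
      have "S M / pi = (\<Sum>k<M. 1 / (pi * (real k + 2)))"
        by (simp add: S_def sum_divide_distrib mult.commute)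
      also have "\<dots> \<le> (\<Sum>k<M. \<bar>hilbert_transform (\<phi> (j + 1 + k)) t\<bar>)"
      proof (rule sum_mono)
        fix k
        have "1 / (pi * (real k + 2)) \<le> (real (j + 1 + k) + 1 - real (j + 1 + k)) / (pi * (real (j + 1 + k) + 1 - t))"
          using j by (intro frac_le mult_left_mono mult_pos_pos) auto
        also have "\<dots> \<le> \<bar>hilbert_transform (\<phi> (j + 1 + k)) t\<bar>"
          unfolding \<phi>_def by (rule abs_hilbert_transform_indicator_ge) (use j in auto)
        finally show "1 / (pi * (real k + 2)) \<le> \<bar>hilbert_transform (\<phi> (j + 1 + k)) t\<bar>" .
      qed
      also have "\<dots> = (\<Sum>i\<in>(\<lambda>k. j + 1 + k) ` {..<M}. \<bar>hilbert_transform (\<phi> i) t\<bar>)"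
        by (subst sum.reindex) (auto simp: inj_on_def)
      also have "\<dots> \<le> (\<Sum>i<2 * M. \<bar>hilbert_transform (\<phi> i) t\<bar>)"
        using j by (intro sum_mono2) auto
      finally have "h \<le> 1 / 2 * (\<Sum>i<2 * M. \<bar>hilbert_transform (\<phi> i) t\<bar>)"
        by (simp add: h_def)
      also have "\<dots> \<le> norm (\<Sum>i<2 * M. hilbert_transform (\<phi> i) t *\<^sub>R y i)"
        using y1 by (rule spec)
      finally show ?thesis .
    qed
    have M_int: "has_bochner_integral lebesgue (\<lambda>t. h\<^sup>2 * indicator {0..<real M} t) (h\<^sup>2 * M)"
      using has_bochner_integral_real_indicator[of "{0..<real M}" lebesgue]
      by (intro has_bochner_integral_mult_right) (auto simp: measure_completion emeasure_completion)
    have "h\<^sup>2 * M = (LINT t|lebesgue. h\<^sup>2 * indicator {0..<real M} t)"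
      using M_int by (simp add: has_bochner_integral_iff)
    also have "\<dots> \<le> (LINT t|lebesgue. (norm (T f t))\<^sup>2)"
    proof (rule integral_mono_AE)
      show "integrable lebesgue (\<lambda>t. h\<^sup>2 * indicator {0..<real M} t)"
        using M_int by (simp add: has_bochner_integral_iff)
      show "integrable lebesgue (\<lambda>t. (norm (T f t))\<^sup>2)"
        using TL[OF f_L2] by (simp add: bochner_L2_def)
      show "AE t in lebesgue. h\<^sup>2 * indicator {0..<real M} t \<le> (norm (T f t))\<^sup>2"
        using AE
      proof eventually_elim
        case (elim t)
        show ?case
          unfolding elim using low[of t] h by (auto simp: indicator_def intro!: power_mono)
      qed
    qed
    also have "\<dots> = (bochner_L2_norm (T f))\<^sup>2" by (simp add: bochner_L2_norm_def)
    also have "\<dots> \<le> (C * bochner_L2_norm f)\<^sup>2"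
      using C[OF f_L2] by (intro power_mono) (auto simp: bochner_L2_norm_def)
    also have "\<dots> \<le> C\<^sup>2 * (8 * M)"
      unfolding power_mult_distrib by (intro mult_left_mono f_le) simp
    \<comment> \<open>The length \<open>M\<close> cancels, so the bound on \<open>h\<close> does not
      depend on \<open>M\<close>, against the choice of \<open>M\<close>.\<close>
    finally have "h\<^sup>2 * M \<le> (8 * C\<^sup>2) * M" by simp
    then have "h\<^sup>2 \<le> 8 * C\<^sup>2" by (rule mult_right_le_imp_le) (simp add: M_def)
    also have "\<dots> \<le> (3 * \<bar>C\<bar>)\<^sup>2" by (simp add: power_mult_distrib)
    finally have "h \<le> 3 * \<bar>C\<bar>" by (rule power2_le_imp_le) simp
    moreover have "3 * \<bar>C\<bar> < 3 * (\<bar>C\<bar> + 1)" by simp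
    ultimately show False using h by (meson not_le order_trans)
  qed
  moreover have "2 \<le> 2 * M" by (simp add: M_def)
  ultimately show thesis using that by blast
qed

section \<open>Type and cotype indices of a UMD space\<close>

theorem theorem3p4:
  assumes "UMD TYPE('a::banach)"
  shows "1 < type_index TYPE('a) \<and> cotype_index TYPE('a) < \<infinity>"
proof
  obtain N :: nat where N: "2 \<le> N"
    and no_ell1: "\<nexists>y :: nat \<Rightarrow> 'a. (\<forall>i<N. norm (y i) \<le> 2) \<and>
      (\<forall>a. 1 / 2 * (\<Sum>i<N. \<bar>a i\<bar>) \<le> norm (\<Sum>i<N. a i *\<^sub>R y i))"
    using UMD_not_ell1[OF assms] .
  \<comment> \<open>Otherwise every constant below \<open>N\<close> fails, and the almost extremal
    families would yield the excluded copy of \<open>ell_1^N\<close>.\<close>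
  have "\<exists>c::real. 0 < c \<and> c < N \<and>
      (\<forall>y :: nat \<Rightarrow> 'a. rad2 {..<N} y \<le> c * (\<Sum>i<N. (norm (y i))\<^sup>2))"
  proof (rule ccontr)
    assume "\<not> ?thesis"
    then have "\<exists>y :: nat \<Rightarrow> 'a. c * (\<Sum>i<N. (norm (y i))\<^sup>2) < rad2 {..<N} y"
      if "0 < c" "c < N" for c :: real
      using that not_le by blast
    from ell1_of_rad2_large[OF _ this] no_ell1 N show False by simp
  qed
  then obtain c :: real where c: "0 < c" "c < N"
    "\<And>y :: nat \<Rightarrow> 'a. rad2 {..<N} y \<le> c * (\<Sum>i<N. (norm (y i))\<^sup>2)"
    by blast
  obtain p K :: real where p: "1 < p" "p \<le> 2" and K: "\<forall>(I :: nat set) (x :: nat \<Rightarrow> 'a). finite I \<longrightarrow>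
      sign_mean I (\<lambda>A. norm (signed_sum I x A) powr p) \<le> K * (\<Sum>i\<in>I. norm (x i) powr p)"
    using type_of_rad2_le[OF c(3,1,2) N] .
  have "rademacher_type TYPE('a) p"
    unfolding rademacher_type_def integral_rademacher[of "\<lambda>z. z powr p"] using K
    by (intro exI[of _ K]) simp
  then have "p \<le> type_index TYPE('a)"
    unfolding type_index_def using p by (intro cSup_upper) (auto intro!: bdd_aboveI[of _ 2])
  then show "1 < type_index TYPE('a)" using p by simp

  \<comment> \<open>Here \<open>2 ^ N\<close> vectors are taken, because \<open>ell_1^N\<close> is
    found inside \<open>ell_infinity\<close> of that dimension.\<close>
  have "\<exists>d::real. 0 < d \<and> d < 2 ^ N \<and>
      (\<forall>y :: nat \<Rightarrow> 'a. (\<Sum>i<2 ^ N. (norm (y i))\<^sup>2) \<le> d * rad2 {..<2 ^ N} y)"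
  proof (rule ccontr)
    assume "\<not> ?thesis"
    then have "\<exists>y :: nat \<Rightarrow> 'a. d * rad2 {..<2 ^ N} y < (\<Sum>i<2 ^ N. (norm (y i))\<^sup>2)"
      if "0 < d" "d < 2 ^ N" for d :: real
      using that not_le by blast
    from ell1_of_rad2_small[OF this] no_ell1 show False by simp
  qed
  then obtain d :: real where d: "0 < d" "d < real (2 ^ N)"
    "\<And>y :: nat \<Rightarrow> 'a. (\<Sum>i<2 ^ N. (norm (y i))\<^sup>2) \<le> d * rad2 {..<2 ^ N} y"
    by auto
  obtain q :: nat and L :: real where q: "2 \<le> q"
    and L: "\<forall>(I :: nat set) (x :: nat \<Rightarrow> 'a). finite I \<longrightarrow>
      (\<Sum>i\<in>I. norm (x i) ^ q) \<le> L * sign_mean I (\<lambda>A. norm (signed_sum I x A) ^ q)"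
    using cotype_of_le_rad2[OF d(3,1,2)] .
  \<comment> \<open>At \<open>v = 0\<close> both sides vanish because \<open>q\<close> is
    positive.\<close>
  have pow: "norm v powr real q = norm v ^ q" for v :: 'a
    using q by (cases "v = 0") (auto simp: powr_realpow)
  have "rademacher_cotype TYPE('a) (ereal q)"
    unfolding rademacher_cotype_def integral_rademacher[of "\<lambda>z. z powr real_of_ereal (ereal q)"]
    using L by (auto simp: pow intro!: exI[of _ L])
  then have "cotype_index TYPE('a) \<le> ereal q"
    unfolding cotype_index_def using q by (intro Inf_lower) auto
  then show "cotype_index TYPE('a) < \<infinity>" by auto
qed

end
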